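(* Let $M$ be a connected smooth 4-manifold without boundary and let $S$ and $\tilde S$ be non-degenerate Hermitian first order sesquilinear forms acting on sections of the trivial $\mathbb{C}^2$-bundle over $M$, with full symbols $\mathbf{S}_{\mathrm{full}}(x,p)$ and $\tilde{\mathbf{S}}_{\mathrm{full}}(x,p)$. Then $\mathbf{S}_{\mathrm{full}}$ and $\tilde{\mathbf{S}}_{\mathrm{full}}$ are $SL$-equivalent if and only if all of the following hold: (i) the metrics encoded within these symbols are the same; (ii) the electromagnetic covector potentials encoded within these symbols are the same; (iii) their topological charges are the same; (iv) their temporal charges are the same; (v) they have the same spin structure.
   Context: Local coordinates on $M$ are $x^\alpha$, $\alpha=1,\dots,4$; repeated indices are summed; subscripts $x^\alpha,p_\alpha$ denote partial derivatives; $M$ need not be compact. **Forms and symbols.** A first order sesquilinear form on $C_0^\infty(M,\mathbb{C}^2)$ is a functional $S(u,v)=\int_M[u^*\mathbf{A}^\alpha v_{x^\alpha}+u_{x^\alpha}^*\mathbf{B}^\alpha v+u^*\mathbf{C}v]\,dx$ with smooth complex $2\times 2$ matrix-functions ($\mathbf{A}^\alpha,\mathbf{B}^\alpha$ vector densities, $\mathbf{C}$ a density). It has a unique canonical representation $$S(u,v)=\int_M\Big[-\tfrac i2u^*\mathbf{E}^\alpha v_{x^\alpha}+\tfrac i2u_{x^\alpha}^*\mathbf{E}^\alpha v+u^*\mathbf{F}v\Big]dx .$$ Symbols: $\mathbf{S}_{\mathrm{prin}}(x,p)=\mathbf{E}^\alpha(x)p_\alpha$, $\mathbf{S}_{\mathrm{sub}}(x)=\mathbf{F}(x)$,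 $\mathbf{S}_{\mathrm{full}}=\mathbf{S}_{\mathrm{prin}}+\mathbf{S}_{\mathrm{sub}}$, $(x,p)\in T^*M$. $S$ is Hermitian ($S(u,v)=\overline{S(v,u)}$) iff $\mathbf{S}_{\mathrm{full}}$ is Hermitian. $S$ is non-degenerate if the matrix $\mathbf{S}_{\mathrm{prin}}(x,p)\neq0$ for all $(x,p)$ with $p\ne0$. **$SL$-equivalence.** $\mathbf{S}_{\mathrm{full}}$ and $\tilde{\mathbf{S}}_{\mathrm{full}}$ are $SL$-equivalent if there is a smooth $R:M\to SL(2,\mathbb{C})$ with $$\tilde{\mathbf{S}}_{\mathrm{full}}=R^*\mathbf{S}_{\mathrm{full}}R+\tfrac i2\big[R^*_{x^\alpha}(\mathbf{S}_{\mathrm{full}})_{p_\alpha}R-R^*(\mathbf{S}_{\mathrm{full}})_{p_\alpha}R_{x^\alpha}\big],$$ equivalently $\tilde S(u,v)=S(Ru,Rv)$. **Metric.** Define $\mathbf{g}^{\alpha\beta}$ (real symmetric) by $\det\mathbf{S}_{\mathrm{prin}}(x,p)=-\mathbf{g}^{\alpha\beta}(x)p_\alpha p_\beta$; it has Lorentzian signature (three positive, one negative eigenvalue). Put $\rho=(-\det\mathbf{g}^{\mu\nu})^{1/6}$ (a density). The encoded Lorentzian metric is $g^{\alpha\beta}=\rho^{-2}\mathbf{g}^{\alpha\beta}$. **Electromagnetic covector potential.** Let $\mathbf{g}_{\alpha\beta}$ be the inverse of $\mathbf{g}^{\alpha\beta}$, $\{F,G,H\}:=F_{x^\alpha}GH_{p_\alpha}-F_{p_\alpha}GH_{x^\alpha}$,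 $\operatorname{adj}$ the matrix adjugate, and $$\mathbf{S}_{\mathrm{csub}}=\mathbf{S}_{\mathrm{sub}}+\tfrac i{16}\,\mathbf{g}_{\alpha\beta}\{\mathbf{S}_{\mathrm{prin}},\operatorname{adj}\mathbf{S}_{\mathrm{prin}},\mathbf{S}_{\mathrm{prin}}\}_{p_\alpha p_\beta}.$$ The potential $A$ is the unique real covector field with $\mathbf{S}_{\mathrm{csub}}(x)=\mathbf{S}_{\mathrm{prin}}(x,A(x))$. **Charges.** Existence of a non-degenerate form makes $M$ parallelizable; fix an orientation of $M$. Let $s^1=\begin{pmatrix}0&1\\1&0\end{pmatrix}$, $s^2=\begin{pmatrix}0&-i\\i&0\end{pmatrix}$, $s^3=\begin{pmatrix}1&0\\0&-1\end{pmatrix}$, $s^4=\mathrm{Id}$. Write uniquely $\mathbf{S}_{\mathrm{prin}}(x,p)=\rho(x)\,s^je_j{}^\alpha(x)p_\alpha$; then $e_1,\dots,e_4$ are global vector fields, Lorentz-orthonormal for $g$ with $e_4$ timelike. The topological charge is $c_{\mathrm{top}}=\operatorname{sgn}\det(e_j{}^\alpha)$ in positively oriented coordinates. The vector field $t$ defined by $\rho^{-1}\operatorname{tr}\mathbf{S}_{\mathrm{prin}}(x,p)=t^\alpha(x)p_\alpha$ is timelike. Fix a reference covector field $q$, timelike for the metric (the same $q$ is used for both symbols, whose metrics coincide). The temporal charge is $c_{\mathrm{tem}}=\operatorname{sgn}t(q)$. **Spin structure.** Among symbols with a given metric and with the same topological and temporal charges, the spin structure of $\mathbf{S}$ is the equivalence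 class of all $\tilde{\mathbf{S}}$ such that $\tilde{\mathbf{S}}_{\mathrm{prin}}=R^*\mathbf{S}_{\mathrm{prin}}R$ for some $R\in C^\infty(M,SL(2,\mathbb{C}))$. *)

theory Defs
  imports "HOL-Analysis.Analysis"
begin

section \<open>Smooth functions and smooth 4-manifolds\<close>

text \<open>Intended for open sets only: on an open set \<open>S\<close> this is C^n in the usual sense.\<close>

primrec Cn_on :: "nat \<Rightarrow> 'a::euclidean_space set \<Rightarrow> ('a \<Rightarrow> 'b::real_normed_vector) \<Rightarrow> bool" where
  "Cn_on 0 S f \<longleftrightarrow> continuous_on S f"
| "Cn_on (Suc n) S f \<longleftrightarrow> (\<forall>x\<in>S. f differentiable (at x)) \<and>
     (\<forall>b\<in>Basis. Cn_on n S (\<lambda>x. frechet_derivative f (at x) b))"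

definition smooth_on :: "'a::euclidean_space set \<Rightarrow> ('a \<Rightarrow> 'b::real_normed_vector) \<Rightarrow> bool" where
  "smooth_on S f \<longleftrightarrow> (\<forall>n. Cn_on n S f)"

definition partial :: "4 \<Rightarrow> (real^4 \<Rightarrow> 'b::real_normed_vector) \<Rightarrow> real^4 \<Rightarrow> 'b" where
  "partial \<alpha> f y = frechet_derivative f (at y) (axis \<alpha> 1)"

text \<open>
  The manifold \<open>M\<close> is the whole type \<open>'m\<close>. A chart consists of its domain and its coordinate
  map; the values of the coordinate map outside the domain are irrelevant. The index type \<open>4\<close>
  is used for the indices 1, 2, 3, 4 (with 4 = 0 in this type).
\<close>

type_synonym 'm chart = "'m set \<times> ('m \<Rightarrow> real^4)"

abbreviation domc :: "'m chart \<Rightarrow> 'm set" where "domc \<equiv> fst"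
abbreviation coord :: "'m chart \<Rightarrow> 'm \<Rightarrow> real^4" where "coord \<equiv> snd"

definition point :: "'m chart \<Rightarrow> real^4 \<Rightarrow> 'm" where
  "point c = inv_into (domc c) (coord c)"

definition is_chart :: "'m::topological_space chart \<Rightarrow> bool" where
  "is_chart c \<longleftrightarrow> open (domc c) \<and> open (coord c ` domc c) \<and>
     homeomorphism (domc c) (coord c ` domc c) (coord c) (point c)"

definition smoothly_compatible :: "'m chart \<Rightarrow> 'm chart \<Rightarrow> bool" where
  "smoothly_compatible c d \<longleftrightarrow>
     smooth_on (coord c ` (domc c \<inter> domc d)) (coord d \<circ> point c) \<and>
     smooth_on (coord d ` (domc c \<inter> domc d)) (coord c \<circ> point d)"

text \<open>A smooth structure is a maximal smooth atlas.\<close>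

definition smooth_structure :: "'m::topological_space chart set \<Rightarrow> bool" where
  "smooth_structure \<A> \<longleftrightarrow>
     (\<forall>c\<in>\<A>. is_chart c) \<and> (\<Union>c\<in>\<A>. domc c) = UNIV \<and>
     (\<forall>c\<in>\<A>. \<forall>d\<in>\<A>. smoothly_compatible c d) \<and>
     (\<forall>c. is_chart c \<longrightarrow> (\<forall>d\<in>\<A>. smoothly_compatible c d) \<longrightarrow> c \<in> \<A>)"

definition smooth_map :: "'m chart set \<Rightarrow> ('m \<Rightarrow> 'b::real_normed_vector) \<Rightarrow> bool" where
  "smooth_map \<A> f \<longleftrightarrow> (\<forall>c\<in>\<A>. smooth_on (coord c ` domc c) (f \<circ> point c))"

text \<open>The partial derivative with respect to the \<open>\<alpha>\<close>-th coordinate of the chart \<open>c\<close>.\<close>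

definition pd :: "'m chart \<Rightarrow> 4 \<Rightarrow> ('m \<Rightarrow> 'b::real_normed_vector) \<Rightarrow> 'm \<Rightarrow> 'b" where
  "pd c \<alpha> f x = partial \<alpha> (f \<circ> point c) (coord c x)"

text \<open>The entry \<open>(\<alpha>, \<beta>)\<close> is the derivative of the \<open>\<alpha>\<close>-th coordinate of \<open>d\<close> in the
  direction of the \<open>\<beta>\<close>-th coordinate of \<open>c\<close>.\<close>

definition transition_jacobian :: "'m chart \<Rightarrow> 'm chart \<Rightarrow> 'm \<Rightarrow> real^4^4" where
  "transition_jacobian c d x = jacobian (coord d \<circ> point c) (at (coord c x))"

text \<open>An orientation, given by an atlas of positively oriented charts.\<close>

definition oriented_atlas :: "'m chart set \<Rightarrow> 'm chart set \<Rightarrow> bool" where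
  "oriented_atlas \<A> \<O> \<longleftrightarrow> \<O> \<subseteq> \<A> \<and> (\<Union>c\<in>\<O>. domc c) = UNIV \<and>
     (\<forall>c\<in>\<O>. \<forall>d\<in>\<O>. \<forall>x\<in>domc c \<inter> domc d. det (transition_jacobian c d x) > 0)"

section \<open>Fields and densities, given by their components in each chart\<close>

text \<open>
  A field is a function of a chart and a point; only its values at the points of the domain of
  the chart matter, so that two fields are identified if they agree there.
\<close>

definition same_field :: "'m chart set \<Rightarrow> ('m chart \<Rightarrow> 'm \<Rightarrow> 'b) \<Rightarrow> ('m chart \<Rightarrow> 'm \<Rightarrow> 'b) \<Rightarrow> bool" where
  "same_field \<A> f g \<longleftrightarrow> (\<forall>c\<in>\<A>. \<forall>x\<in>domc c. f c x = g c x)"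

definition smooth_density :: "'m chart set \<Rightarrow> ('m chart \<Rightarrow> 'm \<Rightarrow> 'b::real_normed_vector) \<Rightarrow> bool" where
  "smooth_density \<A> C \<longleftrightarrow>
     (\<forall>c\<in>\<A>. smooth_on (coord c ` domc c) (C c \<circ> point c)) \<and>
     (\<forall>c\<in>\<A>. \<forall>d\<in>\<A>. \<forall>x\<in>domc c \<inter> domc d.
        C c x = \<bar>det (transition_jacobian c d x)\<bar> *\<^sub>R C d x)"

definition smooth_vector_density ::
    "'m chart set \<Rightarrow> ('m chart \<Rightarrow> 4 \<Rightarrow> 'm \<Rightarrow> 'b::real_normed_vector) \<Rightarrow> bool" where
  "smooth_vector_density \<A> A \<longleftrightarrow>
     (\<forall>c\<in>\<A>. \<forall>\<alpha>. smooth_on (coord c ` domc c) (A c \<alpha> \<circ> point c)) \<and>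
     (\<forall>c\<in>\<A>. \<forall>d\<in>\<A>. \<forall>x\<in>domc c \<inter> domc d. \<forall>\<alpha>.
        (\<Sum>\<beta>\<in>UNIV. (transition_jacobian c d x $ \<alpha> $ \<beta>) *\<^sub>R A c \<beta> x) =
          \<bar>det (transition_jacobian c d x)\<bar> *\<^sub>R A d \<alpha> x)"

definition smooth_covector_field :: "'m chart set \<Rightarrow> ('m chart \<Rightarrow> 'm \<Rightarrow> real^4) \<Rightarrow> bool" where
  "smooth_covector_field \<A> q \<longleftrightarrow>
     (\<forall>c\<in>\<A>. smooth_on (coord c ` domc c) (q c \<circ> point c)) \<and>
     (\<forall>c\<in>\<A>. \<forall>d\<in>\<A>. \<forall>x\<in>domc c \<inter> domc d.
        q c x = transpose (transition_jacobian c d x) *v q d x)"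

text \<open>
  The integral over \<open>M\<close> of a compactly supported density \<open>\<omega>\<close>: cut a set containing the support of
  \<open>\<omega>\<close> into finitely many disjoint Borel pieces \<open>K c\<close>, each inside the domain of the chart \<open>c\<close>,
  and add up the coordinate integrals over the pieces. The integral is the common value obtained
  from all such decompositions (the change of variables formula makes them agree, and they exist
  because finitely many chart domains cover the support).
\<close>

definition has_density_integral ::
    "'m::topological_space chart set \<Rightarrow> ('m chart \<Rightarrow> 'm \<Rightarrow> complex) \<Rightarrow> complex \<Rightarrow> bool" where
  "has_density_integral \<A> \<omega> I \<longleftrightarrow>
     (\<forall>D K. finite D \<and> D \<subseteq> \<A> \<and> disjoint_family_on K D \<and>
            (\<forall>c\<in>D. K c \<in> sets borel \<and> K c \<subseteq> domc c) \<and>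
            (\<forall>c\<in>\<A>. \<forall>x \<in> domc c - (\<Union>d\<in>D. K d). \<omega> c x = 0)
        \<longrightarrow> I = (\<Sum>c\<in>D. LINT y:(coord c ` K c)|lborel. \<omega> c (point c y)))"

section \<open>Matrices\<close>

definition cprod :: "complex^2 \<Rightarrow> complex^2 \<Rightarrow> complex" where
  "cprod u w = (\<Sum>i\<in>UNIV. cnj (u $ i) * w $ i)"

definition ctranspose :: "complex^2^2 \<Rightarrow> complex^2^2" where
  "ctranspose A = (\<chi> i j. cnj (A $ j $ i))"

definition cscale :: "complex \<Rightarrow> complex^2^2 \<Rightarrow> complex^2^2" where
  "cscale z A = (\<chi> i j. z * A $ i $ j)"

definition adjugate2 :: "complex^2^2 \<Rightarrow> complex^2^2" where
  "adjugate2 A = vector [vector [A$2$2, - A$1$2], vector [- A$2$1, A$1$1]]"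

definition pauli :: "4 \<Rightarrow> complex^2^2" where
  "pauli j =
     (if j = 1 then vector [vector [0, 1], vector [1, 0]]
      else if j = 2 then vector [vector [0, - \<i>], vector [\<i>, 0]]
      else if j = 3 then vector [vector [1, 0], vector [0, - 1]]
      else mat 1)"

section \<open>First order sesquilinear forms and their symbols\<close>

type_synonym 'm sesq_form = "('m \<Rightarrow> complex^2) \<Rightarrow> ('m \<Rightarrow> complex^2) \<Rightarrow> complex"
type_synonym 'm vec_coeff = "'m chart \<Rightarrow> 4 \<Rightarrow> 'm \<Rightarrow> complex^2^2"
type_synonym 'm coeff = "'m chart \<Rightarrow> 'm \<Rightarrow> complex^2^2"
type_synonym 'm symbol = "'m chart \<Rightarrow> 'm \<Rightarrow> real^4 \<Rightarrow> complex^2^2"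

definition test_functions :: "'m::topological_space chart set \<Rightarrow> ('m \<Rightarrow> complex^2) set" where
  "test_functions \<A> = {u. smooth_map \<A> u \<and> (\<exists>K. compact K \<and> (\<forall>x. x \<notin> K \<longrightarrow> u x = 0))}"

definition form_density :: "'m vec_coeff \<Rightarrow> 'm vec_coeff \<Rightarrow> 'm coeff \<Rightarrow>
    ('m \<Rightarrow> complex^2) \<Rightarrow> ('m \<Rightarrow> complex^2) \<Rightarrow> 'm chart \<Rightarrow> 'm \<Rightarrow> complex" where
  "form_density A B C u v c x =
     (\<Sum>\<alpha>\<in>UNIV. cprod (u x) (A c \<alpha> x *v pd c \<alpha> v x)) +
     (\<Sum>\<alpha>\<in>UNIV. cprod (pd c \<alpha> u x) (B c \<alpha> x *v v x)) +
     cprod (u x) (C c x *v v x)"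

definition represents :: "'m::topological_space chart set \<Rightarrow>
    'm vec_coeff \<Rightarrow> 'm vec_coeff \<Rightarrow> 'm coeff \<Rightarrow> 'm sesq_form \<Rightarrow> bool" where
  "represents \<A> A B C S \<longleftrightarrow>
     smooth_vector_density \<A> A \<and> smooth_vector_density \<A> B \<and> smooth_density \<A> C \<and>
     (\<forall>u\<in>test_functions \<A>. \<forall>v\<in>test_functions \<A>.
        has_density_integral \<A> (form_density A B C u v) (S u v))"

definition first_order_form :: "'m::topological_space chart set \<Rightarrow> 'm sesq_form \<Rightarrow> bool" where
  "first_order_form \<A> S \<longleftrightarrow> (\<exists>A B C. represents \<A> A B C S)"

definition canonical_representation :: "'m::topological_space chart set \<Rightarrow>
    'm sesq_form \<Rightarrow> 'm vec_coeff \<Rightarrow> 'm coeff \<Rightarrow> bool" where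
  "canonical_representation \<A> S E F \<longleftrightarrow>
     smooth_vector_density \<A> E \<and> smooth_density \<A> F \<and>
     represents \<A> (\<lambda>c \<alpha> x. cscale (- (\<i> / 2)) (E c \<alpha> x)) (\<lambda>c \<alpha> x. cscale (\<i> / 2) (E c \<alpha> x)) F S"

definition hermitian_form :: "'m::topological_space chart set \<Rightarrow> 'm sesq_form \<Rightarrow> bool" where
  "hermitian_form \<A> S \<longleftrightarrow>
     (\<forall>u\<in>test_functions \<A>. \<forall>v\<in>test_functions \<A>. S u v = cnj (S v u))"

definition prin_symbol :: "'m vec_coeff \<Rightarrow> 'm symbol" where
  "prin_symbol E c x p = (\<Sum>\<alpha>\<in>UNIV. (p $ \<alpha>) *\<^sub>R E c \<alpha> x)"

definition sub_symbol :: "'m coeff \<Rightarrow> 'm coeff" where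
  "sub_symbol F c x = F c x"

definition full_symbol :: "'m vec_coeff \<Rightarrow> 'm coeff \<Rightarrow> 'm symbol" where
  "full_symbol E F c x p = prin_symbol E c x p + sub_symbol F c x"

definition nondegenerate :: "'m chart set \<Rightarrow> 'm vec_coeff \<Rightarrow> bool" where
  "nondegenerate \<A> E \<longleftrightarrow> (\<forall>c\<in>\<A>. \<forall>x\<in>domc c. \<forall>p. p \<noteq> 0 \<longrightarrow> prin_symbol E c x p \<noteq> 0)"

section \<open>SL-equivalence\<close>

definition smooth_SL2 :: "'m chart set \<Rightarrow> ('m \<Rightarrow> complex^2^2) set" where
  "smooth_SL2 \<A> = {R. smooth_map \<A> R \<and> (\<forall>x. det (R x) = 1)}"

definition SL_equivalent :: "'m chart set \<Rightarrow> 'm symbol \<Rightarrow> 'm symbol \<Rightarrow> bool" where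
  "SL_equivalent \<A> P P' \<longleftrightarrow>
     (\<exists>R\<in>smooth_SL2 \<A>. \<forall>c\<in>\<A>. \<forall>x\<in>domc c. \<forall>p.
        P' c x p =
          ctranspose (R x) ** P c x p ** R x +
          cscale (\<i> / 2) (\<Sum>\<alpha>\<in>UNIV.
            pd c \<alpha> (\<lambda>z. ctranspose (R z)) x ** partial \<alpha> (P c x) p ** R x -
            ctranspose (R x) ** partial \<alpha> (P c x) p ** pd c \<alpha> R x))"

section \<open>The metric\<close>

text \<open>The weight-2 tensor density with upper indices: minus the polarised determinant.\<close>

definition metric_density :: "'m vec_coeff \<Rightarrow> 'm chart \<Rightarrow> 'm \<Rightarrow> real^4^4" where
  "metric_density E c x =
     (THE G. transpose G = G \<and> (\<forall>p. det (prin_symbol E c x p) = - of_real (p \<bullet> (G *v p))))"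

definition rho :: "'m vec_coeff \<Rightarrow> 'm chart \<Rightarrow> 'm \<Rightarrow> real" where
  "rho E c x = root 6 (- det (metric_density E c x))"

definition encoded_metric :: "'m vec_coeff \<Rightarrow> 'm chart \<Rightarrow> 'm \<Rightarrow> real^4^4" where
  "encoded_metric E c x = (1 / (rho E c x)\<^sup>2) *\<^sub>R metric_density E c x"

definition timelike_covector_field ::
    "'m chart set \<Rightarrow> 'm vec_coeff \<Rightarrow> ('m chart \<Rightarrow> 'm \<Rightarrow> real^4) \<Rightarrow> bool" where
  "timelike_covector_field \<A> E q \<longleftrightarrow> smooth_covector_field \<A> q \<and>
     (\<forall>c\<in>\<A>. \<forall>x\<in>domc c. q c x \<bullet> (encoded_metric E c x *v q c x) < 0)"

section \<open>The electromagnetic covector potential\<close>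

definition poisson3 :: "'m chart \<Rightarrow> ('m \<Rightarrow> real^4 \<Rightarrow> complex^2^2) \<Rightarrow> ('m \<Rightarrow> real^4 \<Rightarrow> complex^2^2) \<Rightarrow>
    ('m \<Rightarrow> real^4 \<Rightarrow> complex^2^2) \<Rightarrow> 'm \<Rightarrow> real^4 \<Rightarrow> complex^2^2" where
  "poisson3 c f g h x p =
     (\<Sum>\<alpha>\<in>UNIV.
        pd c \<alpha> (\<lambda>z. f z p) x ** g x p ** partial \<alpha> (h x) p -
        partial \<alpha> (f x) p ** g x p ** pd c \<alpha> (\<lambda>z. h z p) x)"

text \<open>The bracket below is quadratic in the momentum, so that its second momentum derivatives
  may be evaluated at momentum 0.\<close>

definition csub_symbol :: "'m vec_coeff \<Rightarrow> 'm coeff \<Rightarrow> 'm coeff" where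
  "csub_symbol E F c x = sub_symbol F c x +
     cscale (\<i> / 16) (\<Sum>\<alpha>\<in>UNIV. \<Sum>\<beta>\<in>UNIV.
       (matrix_inv (metric_density E c x) $ \<alpha> $ \<beta>) *\<^sub>R
       partial \<beta> (partial \<alpha>
         (poisson3 c (prin_symbol E c) (\<lambda>z p. adjugate2 (prin_symbol E c z p)) (prin_symbol E c) x)) 0)"

definition em_potential :: "'m vec_coeff \<Rightarrow> 'm coeff \<Rightarrow> 'm chart \<Rightarrow> 'm \<Rightarrow> real^4" where
  "em_potential E F c x = (THE a. csub_symbol E F c x = prin_symbol E c x a)"

section \<open>Charges and spin structure\<close>

text \<open>Row \<open>j\<close> of the matrix contains the components of the vector field \<open>e_j\<close>.\<close>

definition frame :: "'m vec_coeff \<Rightarrow> 'm chart \<Rightarrow> 'm \<Rightarrow> real^4^4" where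
  "frame E c x = (THE e. \<forall>p. prin_symbol E c x p =
     rho E c x *\<^sub>R (\<Sum>j\<in>UNIV. \<Sum>\<alpha>\<in>UNIV. (e $ j $ \<alpha> * p $ \<alpha>) *\<^sub>R pauli j))"

text \<open>For a connected manifold and a non-degenerate Hermitian symbol the following two signs do
  not depend on the point (nor on the positively oriented chart, respectively the chart).\<close>

definition topological_charge :: "'m chart set \<Rightarrow> 'm vec_coeff \<Rightarrow> real" where
  "topological_charge \<O> E = (THE s. \<forall>c\<in>\<O>. \<forall>x\<in>domc c. sgn (det (frame E c x)) = s)"

definition time_vector :: "'m vec_coeff \<Rightarrow> 'm chart \<Rightarrow> 'm \<Rightarrow> real^4" where
  "time_vector E c x = (THE t. \<forall>p. trace (prin_symbol E c x p) / of_real (rho E c x) = of_real (t \<bullet> p))"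

definition temporal_charge :: "'m chart set \<Rightarrow> ('m chart \<Rightarrow> 'm \<Rightarrow> real^4) \<Rightarrow> 'm vec_coeff \<Rightarrow> real" where
  "temporal_charge \<A> q E = (THE s. \<forall>c\<in>\<A>. \<forall>x\<in>domc c. sgn (time_vector E c x \<bullet> q c x) = s)"

definition hermitian_symbol :: "'m chart set \<Rightarrow> 'm symbol \<Rightarrow> bool" where
  "hermitian_symbol \<A> P \<longleftrightarrow> (\<forall>c\<in>\<A>. \<forall>x\<in>domc c. \<forall>p. ctranspose (P c x p) = P c x p)"

text \<open>
  The equivalence class of a symbol. Full symbols are encoded by their coefficients, and the class
  ranges over the non-degenerate Hermitian symbols with the same metric and the same charges.
\<close>

definition spin_structure :: "'m chart set \<Rightarrow> 'm chart set \<Rightarrow> ('m chart \<Rightarrow> 'm \<Rightarrow> real^4) \<Rightarrow>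
    'm vec_coeff \<Rightarrow> ('m vec_coeff \<times> 'm coeff) set" where
  "spin_structure \<A> \<O> q E = {(E', F').
     smooth_vector_density \<A> E' \<and> smooth_density \<A> F' \<and>
     hermitian_symbol \<A> (full_symbol E' F') \<and> nondegenerate \<A> E' \<and>
     same_field \<A> (encoded_metric E') (encoded_metric E) \<and>
     topological_charge \<O> E' = topological_charge \<O> E \<and>
     temporal_charge \<A> q E' = temporal_charge \<A> q E \<and>
     (\<exists>R\<in>smooth_SL2 \<A>. \<forall>c\<in>\<A>. \<forall>x\<in>domc c. \<forall>p.
        prin_symbol E' c x p = ctranspose (R x) ** prin_symbol E c x p ** R x)}"

end

theory Submission
  imports Defs
begin

text \<open>
  Everything happens pointwise in a chart, once the matrix-function \<open>R\<close> is given. Write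
  \<open>E\<^sup>\<alpha>\<close> for the coefficients of the principal symbol; the coefficients of a Hermitian form are
  Hermitian matrices, as testing the form with bump functions in a chart shows
  (\<open>hermitian_coefficients\<close>), hence real combinations \<open>\<Sum>\<^sub>j m\<^sub>j\<^sub>\<alpha> s\<^sup>j\<close> of the Pauli
  matrices, and non-degeneracy says that the real matrix \<open>m\<close> is invertible. All encoded objects can
  be read off from \<open>m\<close>: the metric density is \<open>m\<^sup>T \<eta> m\<close> with the Minkowski matrix \<open>\<eta>\<close>, the frame is a
  positive multiple of \<open>m\<close>, and the time vector is a positive multiple of the fourth row of \<open>m\<close>.

  A change \<open>E\<^sup>\<alpha> \<mapsto> R\<^sup>* E\<^sup>\<alpha> R\<close> with \<open>det R = 1\<close> preserves determinants, hence the metric. It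
  acts on \<open>m\<close> by a proper orthochronous Lorentz transformation. That it is proper follows from
  the fact that \<open>det m\<close> is, up to a constant, the imaginary part of
  \<open>tr (E\<^sup>1 adj E\<^sup>2 E\<^sup>3 adj E\<^sup>4)\<close>, which is manifestly invariant (\<open>det_eq_trace_herm\<close>); that it is
  orthochronous follows from the fact that \<open>R\<^sup>* A R\<close> is positive definite when \<open>A\<close> is. So the two
  charges are preserved as well.

  The heart of the matter is that the covariant subprincipal symbol transforms like a matrix,
  \<open>S\<^sub>c\<^sub>s\<^sub>u\<^sub>b \<mapsto> R\<^sup>* S\<^sub>c\<^sub>s\<^sub>u\<^sub>b R\<close>, exactly when the subprincipal symbol transforms by the rule
  with derivatives of \<open>R\<close> that appears in SL-equivalence (\<open>csub_symbol_transform\<close>). The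
  correction term is \<open>\<i>/8\<close> times a contraction of \<open>E\<^sup>\<alpha>\<^sub>x adj E\<^sup>\<beta> E\<^sup>\<gamma> - E\<^sup>\<gamma> adj E\<^sup>\<beta> E\<^sup>\<alpha>\<^sub>x\<close> with the inverse
  metric density \<open>g\<^sub>\<alpha>\<^sub>\<beta>\<close>, summed over \<open>\<gamma>\<close>, where the subscript \<open>x\<close> is the derivative in the
  \<open>\<gamma>\<close>-th coordinate. The derivatives of \<open>R\<close> that it produces are evaluated with the identity
  \<open>\<Sum> g\<^sub>\<alpha>\<^sub>\<beta> E\<^sup>\<alpha> X adj E\<^sup>\<beta> = - 2 (tr X) Id\<close> and its mirror image (\<open>sandwich_contraction\<close>): for \<open>X = Id\<close> it gives the factor \<open>-4\<close>, and for
  \<open>X = R\<^sub>x R\<^sup>-\<^sup>1\<close>, which is traceless because \<open>det R = 1\<close>, it gives \<open>0\<close>.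

  Since \<open>S\<^sub>c\<^sub>s\<^sub>u\<^sub>b\<close> is Hermitian and the \<open>E\<^sup>\<alpha>\<close> span the Hermitian matrices, the potential exists and
  determines \<open>S\<^sub>c\<^sub>s\<^sub>u\<^sub>b\<close>. Therefore SL-equivalence of full symbols means: the principal symbols are
  related by some \<open>R\<close>, and the potentials agree. The existence of \<open>R\<close> is what equality of the spin
  structures provides, because a symbol belongs to its own spin structure; conversely the group laws for
  \<open>R\<close> turn one such \<open>R\<close> into equality of the two classes.
\<close>

section \<open>Calculus of smooth functions and smooth bump functions\<close>

lemma Cn_on_Suc_imp: "Cn_on (Suc n) S f \<Longrightarrow> Cn_on n S f"
proof (induction n arbitrary: f)
  case 0
  then show ?case
    by (auto intro!: continuous_at_imp_continuous_on differentiable_imp_continuous_within)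
next
  case (Suc n)
  have "Cn_on n S (\<lambda>x. frechet_derivative f (at x) b)" if "b \<in> Basis" for b
    using Suc.prems that by (intro Suc.IH) simp
  moreover have "\<forall>x\<in>S. f differentiable (at x)" using Suc.prems by simp
  ultimately show ?case by simp
qed

lemma Cn_on_imp_continuous_on: "Cn_on n S f \<Longrightarrow> continuous_on S f"
  by (induction n) (auto dest: Cn_on_Suc_imp simp del: Cn_on.simps(2))

lemma Cn_on_subset: "Cn_on n S f \<Longrightarrow> T \<subseteq> S \<Longrightarrow> Cn_on n T f"
  by (induction n arbitrary: f) (auto intro: continuous_on_subset)

text \<open>
  Smoothness is checked below on a cover by two kinds of open sets: the domain of a chart and the
  complement of a compact support.
\<close>

lemma Cn_on_local:
  assumes "\<And>x. x \<in> S \<Longrightarrow> \<exists>U. open U \<and> x \<in> U \<and> Cn_on n (S \<inter> U) f"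
  shows "Cn_on n S f"
  using assms
proof (induction n arbitrary: f)
  case 0
  show ?case
    unfolding Cn_on.simps continuous_on_eq_continuous_within
  proof
    fix x assume "x \<in> S"
    then obtain U where U: "open U" "x \<in> U" "continuous_on (S \<inter> U) f"
      using 0[of x] by auto
    then have "continuous (at x within S \<inter> U) f"
      using \<open>x \<in> S\<close> by (simp add: continuous_on_eq_continuous_within)
    moreover have "at x within S \<inter> U = at x within S"
      using U \<open>x \<in> S\<close> by (intro at_within_nhd[of x U]) auto
    ultimately show "continuous (at x within S) f" by simp
  qed
next
  case (Suc n)
  have "f differentiable (at x)" if "x \<in> S" for x
    using Suc.prems[OF that] that by auto
  moreover have "Cn_on n S (\<lambda>x. frechet_derivative f (at x) b)" if "b \<in> Basis" for b
  proof (rule Suc.IH)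
    fix x assume "x \<in> S"
    from Suc.prems[OF this] show "\<exists>U. open U \<and> x \<in> U \<and>
        Cn_on n (S \<inter> U) (\<lambda>x. frechet_derivative f (at x) b)"
      using that by auto
  qed
  ultimately show ?case by simp
qed

lemma Cn_on_Suc_has_derivative:
  "Cn_on (Suc n) S f \<Longrightarrow> x \<in> S \<Longrightarrow> (f has_derivative frechet_derivative f (at x)) (at x)"
  by (simp add: frechet_derivative_works)

lemma Cn_on_cong:
  assumes "open S" and "\<And>x. x \<in> S \<Longrightarrow> f x = g x" and "Cn_on n S f"
  shows "Cn_on n S g"
  using assms(2,3)
proof (induction n arbitrary: f g)
  case 0
  then show ?case using continuous_on_cong by force
next
  case (Suc n)
  have D: "(g has_derivative frechet_derivative f (at x)) (at x)" if "x \<in> S" for x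
  proof (rule has_derivative_transform_within_open[OF _ \<open>open S\<close> that])
    show "(f has_derivative frechet_derivative f (at x)) (at x)"
      using Suc.prems(2) that by (rule Cn_on_Suc_has_derivative)
  qed (use Suc.prems in auto)
  have eq: "frechet_derivative g (at x) = frechet_derivative f (at x)" if "x \<in> S" for x
    using frechet_derivative_at[OF D[OF that]] by simp
  have "\<forall>x\<in>S. g differentiable (at x)" using D differentiable_def by blast
  moreover have "Cn_on n S (\<lambda>x. frechet_derivative g (at x) b)" if "b \<in> Basis" for b
    by (rule Suc.IH[of "\<lambda>x. frechet_derivative f (at x) b"]) (use Suc.prems(2) that eq in auto)
  ultimately show ?case by simp
qed

lemma Cn_on_const [simp]: "Cn_on n S (\<lambda>x. c)"
  by (induction n arbitrary: c) (auto simp: frechet_derivative_const)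

lemma Cn_on_bounded_linear:
  assumes "bounded_linear L" and "open S" and "Cn_on n S f"
  shows "Cn_on n S (\<lambda>x. L (f x))"
  using assms(3)
proof (induction n arbitrary: f)
  case 0
  then show ?case using assms(1) by (auto intro: bounded_linear.continuous_on)
next
  case (Suc n)
  have D: "((\<lambda>x. L (f x)) has_derivative (\<lambda>h. L (frechet_derivative f (at x) h))) (at x)"
    if "x \<in> S" for x
    using Suc.prems that
    by (intro bounded_linear.has_derivative[OF assms(1)] Cn_on_Suc_has_derivative)
  have eq: "frechet_derivative (\<lambda>x. L (f x)) (at x) b = L (frechet_derivative f (at x) b)"
    if "x \<in> S" for x b
    using frechet_derivative_at[OF D[OF that]] by metis
  have "\<forall>x\<in>S. (\<lambda>x. L (f x)) differentiable (at x)" using D differentiable_def by blast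
  moreover have "Cn_on n S (\<lambda>x. frechet_derivative (\<lambda>x. L (f x)) (at x) b)" if "b \<in> Basis" for b
  proof (rule Cn_on_cong[OF \<open>open S\<close>])
    show "Cn_on n S (\<lambda>x. L (frechet_derivative f (at x) b))"
      using Suc.prems that by (intro Suc.IH) auto
  qed (simp add: eq)
  ultimately show ?case by simp
qed

lemma Cn_on_add:
  assumes "open S" and "Cn_on n S f" and "Cn_on n S g"
  shows "Cn_on n S (\<lambda>x. f x + g x)"
  using assms(2,3)
proof (induction n arbitrary: f g)
  case 0
  then show ?case by (auto intro: continuous_intros)
next
  case (Suc n)
  have D: "((\<lambda>x. f x + g x) has_derivative
      (\<lambda>h. frechet_derivative f (at x) h + frechet_derivative g (at x) h)) (at x)"
    if "x \<in> S" for x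
    using Suc.prems that by (intro has_derivative_add Cn_on_Suc_has_derivative)
  have eq: "frechet_derivative (\<lambda>x. f x + g x) (at x) b =
      frechet_derivative f (at x) b + frechet_derivative g (at x) b" if "x \<in> S" for x b
    using frechet_derivative_at[OF D[OF that]] by metis
  have "\<forall>x\<in>S. (\<lambda>x. f x + g x) differentiable (at x)" using D differentiable_def by blast
  moreover have "Cn_on n S (\<lambda>x. frechet_derivative (\<lambda>x. f x + g x) (at x) b)"
    if "b \<in> Basis" for b
  proof (rule Cn_on_cong[OF \<open>open S\<close>])
    show "Cn_on n S (\<lambda>x. frechet_derivative f (at x) b + frechet_derivative g (at x) b)"
      using Suc.prems that by (intro Suc.IH) auto
  qed (simp add: eq)
  ultimately show ?case by simp
qed

lemma Cn_on_sum:
  assumes "open S" and "\<And>i. i \<in> I \<Longrightarrow> Cn_on n S (f i)"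
  shows "Cn_on n S (\<lambda>x. \<Sum>i\<in>I. f i x)"
  using assms(2)
proof (induction I rule: infinite_finite_induct)
  case (insert i I)
  have "Cn_on n S (\<lambda>x. f i x + (\<Sum>i\<in>I. f i x))"
    using insert by (intro Cn_on_add[OF \<open>open S\<close>]) auto
  then show ?case using insert by simp
qed simp_all

lemma Cn_on_bilinear:
  assumes "bounded_bilinear m" and "open S" and "Cn_on n S f" and "Cn_on n S g"
  shows "Cn_on n S (\<lambda>x. m (f x) (g x))"
  using assms(3,4)
proof (induction n arbitrary: f g)
  case 0
  then show ?case using bounded_bilinear.continuous_on[OF assms(1)] by auto
next
  case (Suc n)
  have D: "((\<lambda>x. m (f x) (g x)) has_derivative
      (\<lambda>h. m (f x) (frechet_derivative g (at x) h) + m (frechet_derivative f (at x) h) (g x))) (at x)"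
    if "x \<in> S" for x
    using Suc.prems that
    by (intro bounded_bilinear.FDERIV[OF assms(1)] Cn_on_Suc_has_derivative)
  have eq: "frechet_derivative (\<lambda>x. m (f x) (g x)) (at x) b =
      m (f x) (frechet_derivative g (at x) b) + m (frechet_derivative f (at x) b) (g x)"
    if "x \<in> S" for x b
    using frechet_derivative_at[OF D[OF that]] by metis
  have "\<forall>x\<in>S. (\<lambda>x. m (f x) (g x)) differentiable (at x)" using D differentiable_def by blast
  moreover have "Cn_on n S (\<lambda>x. frechet_derivative (\<lambda>x. m (f x) (g x)) (at x) b)"
    if "b \<in> Basis" for b
  proof (rule Cn_on_cong[OF \<open>open S\<close>])
    show "Cn_on n S (\<lambda>x. m (f x) (frechet_derivative g (at x) b) +
        m (frechet_derivative f (at x) b) (g x))"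
      using Suc.prems that Cn_on_Suc_imp[OF Suc.prems(1)] Cn_on_Suc_imp[OF Suc.prems(2)]
      by (intro Cn_on_add \<open>open S\<close> Suc.IH) auto
  qed (simp add: eq)
  ultimately show ?case by simp
qed

lemma Cn_on_compose:
  fixes f :: "'a::euclidean_space \<Rightarrow> 'b::euclidean_space" and g :: "'b \<Rightarrow> 'c::real_normed_vector"
  assumes "open S" and "open T" and "f ` S \<subseteq> T" and "Cn_on n S f" and "Cn_on n T g"
  shows "Cn_on n S (g \<circ> f)"
  using assms(4,5)
proof (induction n arbitrary: g)
  case 0
  then show ?case using assms(3) by (simp del: o_apply) (metis continuous_on_compose continuous_on_subset)
next
  case (Suc n)
  have Df: "(f has_derivative frechet_derivative f (at x)) (at x)" if "x \<in> S" for x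
    using Suc.prems(1) that by (rule Cn_on_Suc_has_derivative)
  have Dg: "(g has_derivative frechet_derivative g (at (f x))) (at (f x))" if "x \<in> S" for x
    using Suc.prems(2) that assms(3) by (intro Cn_on_Suc_has_derivative) auto
  have D: "(g \<circ> f has_derivative frechet_derivative g (at (f x)) \<circ> frechet_derivative f (at x)) (at x)"
    if "x \<in> S" for x
    by (rule diff_chain_at[OF Df[OF that] Dg[OF that]])
  have eq: "frechet_derivative (g \<circ> f) (at x) b =
      (\<Sum>j\<in>Basis. (frechet_derivative f (at x) b \<bullet> j) *\<^sub>R frechet_derivative g (at (f x)) j)"
    if "x \<in> S" for x b
  proof -
    interpret linear "frechet_derivative g (at (f x))"
      using Dg[OF that] by (rule has_derivative_linear)
    have "frechet_derivative (g \<circ> f) (at x) b =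
        frechet_derivative g (at (f x)) (frechet_derivative f (at x) b)"
      using frechet_derivative_at[OF D[OF that]] by (metis comp_apply)
    also have "\<dots> = frechet_derivative g (at (f x))
        (\<Sum>j\<in>Basis. (frechet_derivative f (at x) b \<bullet> j) *\<^sub>R j)"
      by (simp add: euclidean_representation)
    finally show ?thesis by (simp add: sum scaleR)
  qed
  have "\<forall>x\<in>S. (g \<circ> f) differentiable (at x)" using D differentiable_def by blast
  moreover have "Cn_on n S (\<lambda>x. frechet_derivative (g \<circ> f) (at x) b)" if b: "b \<in> Basis" for b
  proof (rule Cn_on_cong[OF \<open>open S\<close>])
    show "Cn_on n S (\<lambda>x. \<Sum>j\<in>Basis. (frechet_derivative f (at x) b \<bullet> j) *\<^sub>R
        frechet_derivative g (at (f x)) j)"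
    proof (intro Cn_on_sum Cn_on_bilinear[OF bounded_bilinear_scaleR] \<open>open S\<close>)
      fix j :: 'b assume "j \<in> Basis"
      show "Cn_on n S (\<lambda>x. frechet_derivative f (at x) b \<bullet> j)"
        using Suc.prems(1) b
        by (intro Cn_on_bounded_linear[OF bounded_linear_inner_left \<open>open S\<close>]) auto
      show "Cn_on n S (\<lambda>x. frechet_derivative g (at (f x)) j)"
        using Suc.IH[of "\<lambda>y. frechet_derivative g (at y) j"] Suc.prems(2) \<open>j \<in> Basis\<close>
          Cn_on_Suc_imp[OF Suc.prems(1)] by (simp add: comp_def)
    qed
  qed (simp add: eq)
  ultimately show ?case unfolding Cn_on.simps by blast
qed

lemma Cn_on_linear:
  assumes "bounded_linear L" and "open S"
  shows "Cn_on n S L"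
proof -
  have "Cn_on n S (\<lambda>x::'a. x)" 
    by (cases n) (auto simp: frechet_derivative_ident)
  then show ?thesis using Cn_on_bounded_linear[OF assms] by blast
qed

text \<open>
  The extensions by \<open>0\<close> of \<open>exp (-1/t) / t^k\<close>. The powers are included because the family is closed
  under differentiation up to linear combinations, so that smoothness of all members follows by
  induction on the order of differentiability.
\<close>

definition flat_exp :: "nat \<Rightarrow> real \<Rightarrow> real" where
  "flat_exp k t = (if t > 0 then exp (- inverse t) * inverse t ^ k else 0)"

lemma flat_exp_tendsto_0: "(flat_exp k \<longlongrightarrow> 0) (at_right 0)"
proof -
  have "((\<lambda>s::real. s ^ k / exp s) \<longlongrightarrow> 0) at_top"
    by (rule tendsto_power_div_exp_0)
  then have "((\<lambda>t::real. inverse t ^ k / exp (inverse t)) \<longlongrightarrow> 0) (at_right 0)"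
    by (rule filterlim_compose[OF _ filterlim_inverse_at_top_right])
  moreover have "\<forall>\<^sub>F t in at_right 0. inverse t ^ k / exp (inverse t) = flat_exp k t"
    using eventually_at_right_less[of "0::real"]
    by eventually_elim (simp add: flat_exp_def exp_minus divide_inverse mult.commute)
  ultimately show ?thesis
    by (rule Lim_transform_eventually)
qed

lemma flat_exp_has_derivative:
  "(flat_exp k has_real_derivative flat_exp (k + 2) t - of_nat k * flat_exp (k + 1) t) (at t)"
proof -
  consider "t > 0" | "t < 0" | "t = 0" by linarith
  then show ?thesis
  proof cases
    case 1
    let ?s = "inverse t"
    have inv: "(inverse has_real_derivative - ?s\<^sup>2) (at t)"
      using DERIV_inverse[of t UNIV] 1 by (simp add: numeral_2_eq_2)
    have "((\<lambda>t. exp (- inverse t) * inverse t ^ k) has_real_derivative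
        exp (- ?s) * - (- ?s\<^sup>2) * ?s ^ k + of_nat k * (- ?s\<^sup>2 * ?s ^ (k - Suc 0)) * exp (- ?s)) (at t)"
      by (intro DERIV_mult DERIV_fun_exp DERIV_minus DERIV_power inv)
    moreover have "exp (- ?s) * - (- ?s\<^sup>2) * ?s ^ k + of_nat k * (- ?s\<^sup>2 * ?s ^ (k - Suc 0)) * exp (- ?s) =
        flat_exp (k + 2) t - of_nat k * flat_exp (k + 1) t"
      using 1 by (cases k) (simp_all add: flat_exp_def power2_eq_square algebra_simps)
    ultimately have "((\<lambda>t. exp (- inverse t) * inverse t ^ k) has_real_derivative
        flat_exp (k + 2) t - of_nat k * flat_exp (k + 1) t) (at t)"
      by (simp only:)
    then show ?thesis
      by (rule has_field_derivative_transform_within_open[where S = "{0<..}"]) (use 1 in \<open>auto simp: flat_exp_def\<close>)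
  next
    case 2
    have "((\<lambda>t. 0) has_real_derivative flat_exp (k + 2) t - of_nat k * flat_exp (k + 1) t) (at t)"
      using 2 by (simp add: flat_exp_def)
    then show ?thesis
      by (rule has_field_derivative_transform_within_open[where S = "{..<0}"]) (use 2 in \<open>auto simp: flat_exp_def\<close>)
  next
    case 3
    have "((\<lambda>y. (flat_exp k y - flat_exp k 0) / (y - 0)) \<longlongrightarrow> 0) (at 0)"
      unfolding filterlim_at_split
    proof
      show "((\<lambda>y. (flat_exp k y - flat_exp k 0) / (y - 0)) \<longlongrightarrow> 0) (at_left 0)"
        by (rule Lim_transform_eventually[OF tendsto_const])
          (auto simp: flat_exp_def eventually_at_filter)
      show "((\<lambda>y. (flat_exp k y - flat_exp k 0) / (y - 0)) \<longlongrightarrow> 0) (at_right 0)"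
        by (rule Lim_transform_eventually[OF flat_exp_tendsto_0[of "Suc k"]])
          (auto simp: flat_exp_def eventually_at_filter divide_inverse mult_ac)
    qed
    then show ?thesis using 3 by (simp add: has_field_derivative_iff flat_exp_def)
  qed
qed

lemma Cn_on_flat_exp: "Cn_on n UNIV (flat_exp k)"
proof (induction n arbitrary: k)
  case 0
  then show ?case
    using DERIV_isCont[OF flat_exp_has_derivative] by (simp add: continuous_at_imp_continuous_on)
next
  case (Suc n)
  have D: "(flat_exp k has_derivative (\<lambda>h. (flat_exp (k + 2) t - of_nat k * flat_exp (k + 1) t) * h)) (at t)"
    for k t
    using flat_exp_has_derivative[of k t] by (simp add: has_field_derivative_def)
  have "frechet_derivative (flat_exp k) (at t) 1 = flat_exp (k + 2) t - of_nat k * flat_exp (k + 1) t" for t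
    using frechet_derivative_at[OF D, of k t] by (metis mult.right_neutral)
  moreover have "Cn_on n UNIV (\<lambda>t. flat_exp (k + 2) t + (- of_nat k) * flat_exp (k + 1) t)"
    by (intro Cn_on_add open_UNIV Cn_on_bounded_linear[OF bounded_linear_mult_right] Suc.IH)
  ultimately show ?case
    using D[of k] by (auto simp: differentiable_def)
qed

definition bump :: "'a::euclidean_space \<Rightarrow> real \<Rightarrow> 'a \<Rightarrow> real" where
  "bump a r y = flat_exp 0 (r\<^sup>2 - (norm (y - a))\<^sup>2)"

lemma bump_eq_0: "r > 0 \<Longrightarrow> norm (y - a) \<ge> r \<Longrightarrow> bump a r y = 0"
  using power_mono[of r "norm (y - a)" 2] by (simp add: bump_def flat_exp_def not_less)

lemma Cn_on_bump: "Cn_on n UNIV (bump a r)"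
proof -
  have "Cn_on n UNIV (\<lambda>y. r\<^sup>2 + - ((y + - a) \<bullet> (y + - a)))"
    by (intro Cn_on_add Cn_on_const open_UNIV Cn_on_linear[OF bounded_linear_ident] Cn_on_bilinear[OF bounded_bilinear_inner]
        Cn_on_bounded_linear[OF bounded_linear_minus[OF bounded_linear_ident]])
  from Cn_on_compose[OF open_UNIV open_UNIV _ this Cn_on_flat_exp[of n 0]]
  show ?thesis by (simp add: bump_def[abs_def] comp_def power2_norm_eq_inner)
qed

section \<open>Complex two-by-two matrices and Pauli coordinates\<close>

lemmas matrix_entries = vec_eq_iff forall_2 matrix_matrix_mult_def sum_2 ctranspose_def
  adjugate2_def cscale_def mat_def trace_def vector_2

lemma bounded_bilinear_matmul: "bounded_bilinear ((**) :: complex^2^2 \<Rightarrow> complex^2^2 \<Rightarrow> complex^2^2)"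
  unfolding bilinear_conv_bounded_bilinear[symmetric] bilinear_def
  by (intro conjI allI linearI) (simp_all add: matrix_entries algebra_simps)

interpretation matmul: bounded_bilinear "(**) :: complex^2^2 \<Rightarrow> complex^2^2 \<Rightarrow> complex^2^2"
  by (rule bounded_bilinear_matmul)

lemma bounded_linear_ctranspose: "bounded_linear ctranspose"
  by (intro linear_conv_bounded_linear[THEN iffD1] linearI) (simp_all add: matrix_entries)

lemmas ctranspose_linear = linear_add[OF bounded_linear.linear[OF bounded_linear_ctranspose]] linear_diff[OF bounded_linear.linear[OF bounded_linear_ctranspose]] linear_neg[OF bounded_linear.linear[OF bounded_linear_ctranspose]] linear_sum[OF bounded_linear.linear[OF bounded_linear_ctranspose]] linear_scale[OF bounded_linear.linear[OF bounded_linear_ctranspose]] linear_0[OF bounded_linear.linear[OF bounded_linear_ctranspose]]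

lemma bounded_linear_adjugate2: "bounded_linear adjugate2"
  by (intro linear_conv_bounded_linear[THEN iffD1] linearI) (simp_all add: matrix_entries)

lemmas adjugate2_linear = linear_add[OF bounded_linear.linear[OF bounded_linear_adjugate2]] linear_diff[OF bounded_linear.linear[OF bounded_linear_adjugate2]] linear_neg[OF bounded_linear.linear[OF bounded_linear_adjugate2]] linear_sum[OF bounded_linear.linear[OF bounded_linear_adjugate2]] linear_scale[OF bounded_linear.linear[OF bounded_linear_adjugate2]] linear_0[OF bounded_linear.linear[OF bounded_linear_adjugate2]]

lemma bounded_linear_cscale: "bounded_linear (cscale z)"
  by (intro linear_conv_bounded_linear[THEN iffD1] linearI) (simp_all add: matrix_entries algebra_simps)

lemmas cscale_linear = linear_add[OF bounded_linear.linear[OF bounded_linear_cscale]] linear_diff[OF bounded_linear.linear[OF bounded_linear_cscale]] linear_neg[OF bounded_linear.linear[OF bounded_linear_cscale]] linear_sum[OF bounded_linear.linear[OF bounded_linear_cscale]] linear_scale[OF bounded_linear.linear[OF bounded_linear_cscale]] linear_0[OF bounded_linear.linear[OF bounded_linear_cscale]]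

lemma cscale_mult [simp]: "cscale z A ** B = cscale z (A ** B)" "A ** cscale z B = cscale z (A ** B)"
  by (simp_all add: matrix_entries algebra_simps)

lemma ctranspose_cscale [simp]: "ctranspose (cscale z A) = cscale (cnj z) (ctranspose A)"
  by (simp add: matrix_entries)

lemma ctranspose_mult: "ctranspose (A ** B) = ctranspose B ** ctranspose A"
  by (simp add: matrix_entries algebra_simps)

lemma adjugate2_mult: "adjugate2 (A ** B) = adjugate2 B ** adjugate2 A"
  by (simp add: matrix_entries algebra_simps)

lemma adjugate2_ctranspose: "adjugate2 (ctranspose A) = ctranspose (adjugate2 A)"
  by (simp add: matrix_entries)

lemma adjugate2_adjugate2 [simp]: "adjugate2 (adjugate2 A) = A"
  by (simp add: matrix_entries)

lemma det_ctranspose: "det (ctranspose A) = cnj (det A)"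
  by (simp add: matrix_entries det_2)

lemma det_adjugate2: "det (adjugate2 A) = det A"
  by (simp add: matrix_entries det_2)

lemma mult_adjugate2: "A ** adjugate2 A = cscale (det A) (mat 1)" "adjugate2 A ** A = cscale (det A) (mat 1)"
  by (simp_all add: matrix_entries det_2 algebra_simps)

lemma add_adjugate2: "A + adjugate2 A = cscale (trace A) (mat 1)"
  by (simp add: matrix_entries)

lemma cscale_1 [simp]: "cscale 1 A = A" and cscale_0 [simp]: "cscale 0 A = 0"
  by (simp_all add: matrix_entries)

lemma SL2_inverse:
  assumes "det A = 1"
  shows "A ** adjugate2 A = mat 1" "adjugate2 A ** A = mat 1"
  using assms by (simp_all add: mult_adjugate2)

text \<open>
  The real vector space of Hermitian matrices with the Pauli matrices as a basis, identified with
  \<open>\<real>\<^sup>4\<close>; the determinant becomes minus the Minkowski form.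
\<close>

definition herm :: "real^4 \<Rightarrow> complex^2^2" where
  "herm a = (\<Sum>j\<in>UNIV. a $ j *\<^sub>R pauli j)"

definition pauli_coord :: "complex^2^2 \<Rightarrow> real^4" where
  "pauli_coord A = (\<chi> j. Re (trace (pauli j ** A)) / 2)"

lemma herm_entries:
  "herm a $ 1 $ 1 = Complex (a$4 + a$3) 0" "herm a $ 1 $ 2 = Complex (a$1) (- a$2)"
  "herm a $ 2 $ 1 = Complex (a$1) (a$2)" "herm a $ 2 $ 2 = Complex (a$4 - a$3) 0"
  by (simp_all add: herm_def sum_4 pauli_def mat_def vector_2 complex_eq_iff)

lemma bounded_linear_herm: "bounded_linear herm"
  by (intro linear_conv_bounded_linear[THEN iffD1] linearI)
    (simp_all add: vec_eq_iff forall_2 herm_entries complex_eq_iff algebra_simps)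

lemma pauli_coord_entries:
  "pauli_coord A $ 1 = (Re (A$1$2) + Re (A$2$1)) / 2"
  "pauli_coord A $ 2 = (Im (A$2$1) - Im (A$1$2)) / 2"
  "pauli_coord A $ 3 = (Re (A$1$1) - Re (A$2$2)) / 2"
  "pauli_coord A $ 4 = (Re (A$1$1) + Re (A$2$2)) / 2"
  by (simp_all add: pauli_coord_def pauli_def matrix_entries)

lemma herm_pauli_coord:
  assumes "ctranspose A = A"
  shows "herm (pauli_coord A) = A"
proof -
  have "cnj (A$1$1) = A$1$1" "cnj (A$2$1) = A$1$2" "cnj (A$2$2) = A$2$2"
    using assms by (simp_all add: vec_eq_iff forall_2 ctranspose_def)
  then show ?thesis
    by (simp add: vec_eq_iff forall_2 herm_entries pauli_coord_entries complex_eq_iff field_simps)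
qed

lemma pauli_coord_herm [simp]: "pauli_coord (herm a) = a"
  by (simp add: vec_eq_iff forall_4 herm_entries pauli_coord_entries)

lemma herm_inject: "herm a = herm b \<longleftrightarrow> a = b"
  by (metis pauli_coord_herm)

definition minkowski :: "real^4^4" where
  "minkowski = (\<chi> i j. if i = j then (if i = 4 then - 1 else 1) else 0)"

lemma minkowski_quadratic: "a \<bullet> (minkowski *v a) = (a$1)\<^sup>2 + (a$2)\<^sup>2 + (a$3)\<^sup>2 - (a$4)\<^sup>2"
  by (simp add: minkowski_def inner_vec_def matrix_vector_mult_def sum_4 power2_eq_square)

lemma det_herm: "det (herm a) = - of_real (a \<bullet> (minkowski *v a))"
  by (simp add: det_2 herm_entries minkowski_quadratic complex_eq_iff power2_eq_square algebra_simps)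

lemma trace_herm: "trace (herm a) = of_real (2 * a$4)"
  by (simp add: trace_def sum_2 herm_entries complex_eq_iff)

lemma minkowski_square: "minkowski ** minkowski = mat 1"
  by (simp add: vec_eq_iff forall_4 minkowski_def matrix_matrix_mult_def mat_def sum_4)

lemma transpose_minkowski: "transpose minkowski = minkowski"
  by (simp add: vec_eq_iff minkowski_def transpose_def)

lemma det_4:
  fixes A :: "'a::comm_ring_1^4^4"
  shows "det A =
    A$1$1 * (A$2$2 * A$3$3 * A$4$4 + A$2$3 * A$3$4 * A$4$2 + A$2$4 * A$3$2 * A$4$3
       - A$2$4 * A$3$3 * A$4$2 - A$2$3 * A$3$2 * A$4$4 - A$2$2 * A$3$4 * A$4$3)
  - A$1$2 * (A$2$1 * A$3$3 * A$4$4 + A$2$3 * A$3$4 * A$4$1 + A$2$4 * A$3$1 * A$4$3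
       - A$2$4 * A$3$3 * A$4$1 - A$2$3 * A$3$1 * A$4$4 - A$2$1 * A$3$4 * A$4$3)
  + A$1$3 * (A$2$1 * A$3$2 * A$4$4 + A$2$2 * A$3$4 * A$4$1 + A$2$4 * A$3$1 * A$4$2
       - A$2$4 * A$3$2 * A$4$1 - A$2$2 * A$3$1 * A$4$4 - A$2$1 * A$3$4 * A$4$2)
  - A$1$4 * (A$2$1 * A$3$2 * A$4$3 + A$2$2 * A$3$3 * A$4$1 + A$2$3 * A$3$1 * A$4$2
       - A$2$3 * A$3$2 * A$4$1 - A$2$2 * A$3$1 * A$4$3 - A$2$1 * A$3$3 * A$4$2)"
proof -
  have f1: "finite {2::4, 3, 4}" "1 \<notin> {2::4, 3, 4}" by auto
  have f2: "finite {3::4, 4}" "2 \<notin> {3::4, 4}" by auto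
  have f3: "finite {4::4}" "3 \<notin> {4::4}" by auto
  show ?thesis
    unfolding det_def UNIV_4
    unfolding sum_over_permutations_insert[OF f1]
    unfolding sum_over_permutations_insert[OF f2]
    unfolding sum_over_permutations_insert[OF f3]
    unfolding permutes_sing
    by (simp add: sign_swap_id permutation_swap_id permutation_compose sign_compose sign_id swap_id_eq algebra_simps)
qed

lemma det_minkowski: "det minkowski = - 1"
  by (simp add: det_4 minkowski_def)

text \<open>
  For vectors \<open>a\<close>, \<open>b\<close>, \<open>c\<close>, \<open>d\<close> with Hermitian matrices \<open>A\<close>, \<open>B\<close>, \<open>C\<close>, \<open>D\<close>, the matrix
  \<open>A (adj B) C (adj D)\<close> has as real part of its trace products of Minkowski products only; the
  imaginary part is the volume form. This expresses an orientation through matrix products and the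
  trace, whose behaviour under \<open>A \<mapsto> R\<^sup>* A R\<close> is evident.
\<close>

lemma det_eq_trace_herm:
  "Im (trace (herm (a 1) ** adjugate2 (herm (a 2)) ** herm (a 3) ** adjugate2 (herm (a 4)))) =
     - 2 * det (\<chi> j \<alpha>. a \<alpha> $ j)"
  unfolding det_4
  by (simp add: trace_def matrix_matrix_mult_def sum_2 adjugate2_def vector_2 herm_entries algebra_simps)

section \<open>Coefficients of a Hermitian form are Hermitian\<close>

lemma chart_inverse:
  assumes "is_chart c"
  shows "x \<in> domc c \<Longrightarrow> point c (coord c x) = x"
    and "y \<in> coord c ` domc c \<Longrightarrow> coord c (point c y) = y"
    and "y \<in> coord c ` domc c \<Longrightarrow> point c y \<in> domc c"
    and "open (domc c)" and "open (coord c ` domc c)"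
    and "continuous_on (coord c ` domc c) (point c)"
  using assms unfolding is_chart_def homeomorphism_def by auto

lemma open_coord_image:
  assumes "is_chart c" and "open V" and "V \<subseteq> domc c"
  shows "open (coord c ` V)"
proof -
  have "openin (top_of_set (domc c)) V"
    using assms by (simp add: openin_open_eq chart_inverse(4))
  then have "openin (top_of_set (coord c ` domc c)) (coord c ` V)"
    using assms(1) homeomorphism_imp_open_map unfolding is_chart_def by blast
  then show ?thesis using chart_inverse(5)[OF assms(1)] openin_open_trans by blast
qed

definition extend_by_zero :: "'m chart \<Rightarrow> (real^4 \<Rightarrow> 'b::zero) \<Rightarrow> 'm \<Rightarrow> 'b" where
  "extend_by_zero c f x = (if x \<in> domc c then f (coord c x) else 0)"

text \<open>
  In a second chart the extended function is either the given one composed with a transition map,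
  or zero near the point; the complement of the support is open because a compact set is closed in a
  Hausdorff space.
\<close>

lemma smooth_map_extend_by_zero:
  fixes \<A> :: "'m::t2_space chart set" and f :: "real^4 \<Rightarrow> 'b::real_normed_vector"
  assumes \<A>: "smooth_structure \<A>" and c: "c \<in> \<A>" and f: "smooth_on UNIV f"
    and K: "compact K" "K \<subseteq> coord c ` domc c" "\<And>y. y \<notin> K \<Longrightarrow> f y = 0"
  shows "smooth_map \<A> (extend_by_zero c f)"
  unfolding smooth_map_def smooth_on_def
proof (intro ballI allI)
  fix d n assume d: "d \<in> \<A>"
  have charts: "is_chart c" "is_chart d" using \<A> c d by (auto simp: smooth_structure_def)
  note C = chart_inverse[OF charts(1)] and D = chart_inverse[OF charts(2)]
  let ?u = "extend_by_zero c f \<circ> point d" and ?T = "coord d ` domc d"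
  show "Cn_on n ?T ?u"
  proof (rule Cn_on_local)
    fix y assume y: "y \<in> ?T"
    show "\<exists>U. open U \<and> y \<in> U \<and> Cn_on n (?T \<inter> U) ?u"
    proof (cases "point d y \<in> domc c")
      case True
      let ?U = "coord d ` (domc c \<inter> domc d)"
      have U: "open ?U" by (rule open_coord_image[OF charts(2)]) (auto simp: C D)
      have yU: "y \<in> ?U" using True y D by (intro image_eqI[of _ _ "point d y"]) auto
      have "Cn_on n ?U (coord c \<circ> point d)"
        using \<A> c d by (auto simp: smooth_structure_def smoothly_compatible_def smooth_on_def)
      then have "Cn_on n ?U (f \<circ> (coord c \<circ> point d))"
        using f by (intro Cn_on_compose[OF U open_UNIV]) (auto simp: smooth_on_def)
      then have "Cn_on n ?U ?u"
        by (rule Cn_on_cong[OF U, rotated]) (auto simp: extend_by_zero_def D)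
      then show ?thesis using U yU by (auto intro: Cn_on_subset)
    next
      case False
      let ?L = "point c ` K"
      have "compact ?L"
        using K C(6) by (auto intro: compact_continuous_image continuous_on_subset)
      then have "closed ?L" by (rule compact_imp_closed)
      then have U: "open (coord d ` (domc d - ?L))"
        using D(4) by (intro open_coord_image[OF charts(2)]) auto
      have "?L \<subseteq> domc c" using C(3) K(2) by blast
      then have yU: "y \<in> coord d ` (domc d - ?L)"
        using False y D by (intro image_eqI[of _ _ "point d y"]) auto
      have "Cn_on n (coord d ` (domc d - ?L)) ?u"
      proof (rule Cn_on_cong[OF U _ Cn_on_const])
        fix y' assume "y' \<in> coord d ` (domc d - ?L)"
        then have "point d y' \<notin> ?L" using D(1) by auto
        then show "0 = ?u y'"
          using K(3) C(1) by (auto simp: extend_by_zero_def) (metis image_eqI)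
      qed
      then show ?thesis using U yU by (auto intro: Cn_on_subset)
    qed
  qed
qed

lemma test_function_extend_by_zero:
  fixes \<A> :: "'m::t2_space chart set" and f :: "real^4 \<Rightarrow> complex^2"
  assumes "smooth_structure \<A>" and c: "c \<in> \<A>" and "smooth_on UNIV f"
    and K: "compact K" "K \<subseteq> coord c ` domc c" "\<And>y. y \<notin> K \<Longrightarrow> f y = 0"
  shows "extend_by_zero c f \<in> test_functions \<A>"
proof -
  have "is_chart c" using assms by (auto simp: smooth_structure_def)
  note C = chart_inverse[OF this]
  have "compact (point c ` K)"
    using K C(6) by (auto intro: compact_continuous_image continuous_on_subset)
  moreover have "extend_by_zero c f x = 0" if "x \<notin> point c ` K" for x
    using that K(3) C(1) by (auto simp: extend_by_zero_def) (metis image_eqI)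
  ultimately show ?thesis
    unfolding test_functions_def using smooth_map_extend_by_zero[OF assms] by blast
qed

lemma cprod_axis: "cprod (a *\<^sub>R axis i 1) (M *v (b *\<^sub>R axis j 1)) = of_real (a * b) * M $ i $ j"
proof -
  have "cprod (a *\<^sub>R axis i 1) w = of_real a * w $ i" for w
    by (simp add: cprod_def axis_def if_distrib[of "\<lambda>t. t * _"] if_distrib[of cnj] if_distrib[of "\<lambda>t. _ * t"]
        scaleR_conv_of_real[where 'a = complex] cong: if_cong)
  moreover have "(M *v (b *\<^sub>R axis j 1)) $ i = of_real b * M $ i $ j"
    by (simp add: matrix_vector_mult_def axis_def if_distrib[of "\<lambda>t. _ * t"] scaleR_conv_of_real[where 'a = complex]
       mult.commute cong: if_cong)
  ultimately show ?thesis by simp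
qed

lemma pd_extend_by_zero:
  fixes b :: "real^4 \<Rightarrow> real" and e :: "'b::real_normed_vector"
  assumes "is_chart c" and y: "y \<in> coord c ` domc c" and b: "b differentiable (at y)"
  shows "pd c \<alpha> (extend_by_zero c (\<lambda>y. b y *\<^sub>R e)) (point c y) = partial \<alpha> b y *\<^sub>R e"
proof -
  note C = chart_inverse[OF assms(1)]
  have "((\<lambda>y. b y *\<^sub>R e) has_derivative (\<lambda>h. frechet_derivative b (at y) h *\<^sub>R e)) (at y)"
    using b frechet_derivative_works has_derivative_scaleR_left by blast
  then have "(extend_by_zero c (\<lambda>y. b y *\<^sub>R e) \<circ> point c has_derivative (\<lambda>h. frechet_derivative b (at y) h *\<^sub>R e)) (at y)"
    by (rule has_derivative_transform_within_open[OF _ C(5) y]) (simp add: extend_by_zero_def C)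
  from frechet_derivative_at[OF this, symmetric] show ?thesis
    by (simp add: pd_def partial_def C y)
qed

lemma form_density_extend_by_zero:
  fixes a b :: "real^4 \<Rightarrow> real"
  assumes "is_chart c" and y: "y \<in> coord c ` domc c"
    and "a differentiable (at y)" and "b differentiable (at y)"
  shows "form_density A B C (extend_by_zero c (\<lambda>y. a y *\<^sub>R axis i 1)) (extend_by_zero c (\<lambda>y. b y *\<^sub>R axis j 1)) c (point c y) =
    (\<Sum>\<alpha>\<in>UNIV. of_real (a y * partial \<alpha> b y) * A c \<alpha> (point c y) $ i $ j) +
    (\<Sum>\<alpha>\<in>UNIV. of_real (partial \<alpha> a y * b y) * B c \<alpha> (point c y) $ i $ j) +
    of_real (a y * b y) * C c (point c y) $ i $ j"
proof -
  note C = chart_inverse[OF assms(1)]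
  have "extend_by_zero c f (point c y) = f y" for f :: "real^4 \<Rightarrow> complex^2"
    using y by (simp add: extend_by_zero_def C)
  then show ?thesis
    using assms by (simp only: form_density_def pd_extend_by_zero cprod_axis)
qed

text \<open>
  A density supported in one chart is integrated with the decomposition that consists of the whole
  chart domain as its only piece.
\<close>

lemma density_integral_in_chart:
  fixes \<A> :: "'m::t2_space chart set"
  assumes "smooth_structure \<A>" and "c \<in> \<A>"
    and "\<And>x. x \<notin> domc c \<Longrightarrow> u x = 0" and "\<And>x. x \<notin> domc c \<Longrightarrow> v x = 0"
    and "has_density_integral \<A> (form_density A B C u v) I"
  shows "I = (LINT y:(coord c ` domc c)|lborel. form_density A B C u v c (point c y))"
proof -
  have "open (domc c)" using assms(1,2) by (simp add: smooth_structure_def chart_inverse(4))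
  moreover have "form_density A B C u v d x = 0" if "x \<notin> domc c" for d x
    using that assms(3,4) by (simp add: form_density_def cprod_def)
  ultimately have "I = (\<Sum>c'\<in>{c}. LINT y:(coord c' ` domc c)|lborel. form_density A B C u v c' (point c' y))"
    using assms(2,5) unfolding has_density_integral_def
    by (elim allE[of _ "{c}"] allE[of _ "\<lambda>_. domc c"] impE)
      (auto simp: disjoint_family_on_def)
  then show ?thesis by simp
qed

lemma set_integrable_compact_support:
  fixes h :: "'a::euclidean_space \<Rightarrow> 'b::{banach,second_countable_topology}"
  assumes "open \<Omega>" and "compact K" and "K \<subseteq> \<Omega>" and "continuous_on \<Omega> h"
    and "\<And>y. y \<in> \<Omega> \<Longrightarrow> y \<notin> K \<Longrightarrow> h y = 0"
  shows "set_integrable lborel \<Omega> h"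
proof -
  have "integrable lborel (\<lambda>y. indicator K y *\<^sub>R h y)"
    using assms by (intro borel_integrable_compact) (auto intro: continuous_on_subset)
  moreover have "indicator K y *\<^sub>R h y = indicator \<Omega> y *\<^sub>R h y" for y
    using assms(3,5) by (auto simp: indicator_def)
  ultimately show ?thesis by (simp add: set_integrable_def)
qed

lemma continuous_eq_0_if_bump_integrals_0:
  fixes G :: "real^4 \<Rightarrow> complex"
  assumes \<Omega>: "open \<Omega>" and G: "continuous_on \<Omega> G"
    and zero: "\<And>a r. r > 0 \<Longrightarrow> cball a r \<subseteq> \<Omega> \<Longrightarrow> (LINT y:\<Omega>|lborel. of_real ((bump a r y)\<^sup>2) * G y) = 0"
    and y0: "y0 \<in> \<Omega>"
  shows "G y0 = 0"
proof (rule ccontr)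
  assume nz: "G y0 \<noteq> 0"
  \<comment> \<open>Multiplication by \<open>w\<close> turns the value at \<open>y0\<close> into a positive real number.\<close>
  define w where "w = cnj (G y0)"
  define H where "H y = Re (w * G y)" for y
  have H: "continuous_on \<Omega> H" unfolding H_def by (intro continuous_intros G)
  have "H y0 = (norm (G y0))\<^sup>2" unfolding H_def w_def cmod_power2 by (simp add: power2_eq_square)
  then have "H y0 > 0" using nz by simp
  have "open (\<Omega> \<inter> H -` {0<..})"
    using continuous_on_open_vimage[OF \<Omega>] H by (metis open_greaterThan Int_commute)
  then obtain r where r: "r > 0" "cball y0 r \<subseteq> \<Omega> \<inter> H -` {0<..}"
    using y0 \<open>H y0 > 0\<close> by (meson IntI open_contains_cball_eq vimageI greaterThan_iff)
  let ?\<psi> = "bump y0 r"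
  have out: "?\<psi> y = 0" if "y \<notin> cball y0 r" for y
    using that r by (intro bump_eq_0) (auto simp: dist_norm norm_minus_commute)
  have \<psi>: "continuous_on S ?\<psi>" for S
    using Cn_on_bump[of 0] by (auto intro: continuous_on_subset)
  have int: "set_integrable lborel \<Omega> (\<lambda>y. of_real ((?\<psi> y)\<^sup>2) * G y)"
    by (rule set_integrable_compact_support[OF \<Omega>, of "cball y0 r"])
      (use r out in \<open>auto intro!: continuous_intros G \<psi>\<close>)
  let ?h = "\<lambda>y. indicator \<Omega> y *\<^sub>R (of_real ((?\<psi> y)\<^sup>2) * G y)"
  have int': "integrable lborel ?h" using int by (simp add: set_integrable_def)
  have "integral\<^sup>L lborel ?h = 0"
    using zero[of r y0] r by (auto simp: set_lebesgue_integral_def)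
  moreover have wint: "integrable lborel (\<lambda>y. w * ?h y)"
    by (rule integrable_mult_right) (rule int')
  moreover have "integral\<^sup>L lborel (\<lambda>y. w * ?h y) = w * integral\<^sup>L lborel ?h"
    by (rule Bochner_Integration.integral_mult_right) (rule int')
  ultimately have z: "integral\<^sup>L lborel (\<lambda>y. Re (w * ?h y)) = 0"
    by (simp only: Bochner_Integration.integral_Re) simp
  have eq: "Re (w * ?h y) = indicator \<Omega> y * ((?\<psi> y)\<^sup>2 * H y)" for y
    by (simp add: H_def algebra_simps indicator_def)
  have nn: "Re (w * ?h y) \<ge> 0" for y
  proof (cases "y \<in> cball y0 r")
    case True
    then have "H y > 0" using r by auto
    then show ?thesis unfolding eq by (simp add: indicator_def)
  next
    case False
    then show ?thesis unfolding eq by (simp add: out)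
  qed
  have "integrable lborel (\<lambda>y. Re (w * ?h y))" using wint by (rule integrable_Re)
  then have "AE y in lborel. Re (w * ?h y) = 0"
    using z nn by (subst (asm) integral_nonneg_eq_0_iff_AE) auto
  then obtain N where N: "{y \<in> space lborel. \<not> Re (w * ?h y) = 0} \<subseteq> N" "emeasure lborel N = 0" "N \<in> sets lborel"
    by (rule AE_E)
  have "ball y0 r \<subseteq> N"
  proof
    fix y assume y: "y \<in> ball y0 r"
    then have "y \<in> cball y0 r" by simp
    then have "y \<in> \<Omega>" "H y > 0" using r(2) by auto
    moreover have "?\<psi> y > 0"
    proof -
      have "(norm (y - y0))\<^sup>2 < r\<^sup>2"
        using y r by (intro power_strict_mono) (auto simp: dist_norm norm_minus_commute)
      then show ?thesis by (simp add: bump_def flat_exp_def)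
    qed
    ultimately have "Re (w * ?h y) \<noteq> 0" unfolding eq by simp
    then have "y \<in> {y \<in> space lborel. \<not> Re (w * ?h y) = 0}" by (intro CollectI conjI) simp_all
    then show "y \<in> N" using N(1) by (rule subsetD[rotated])
  qed
  then have "emeasure lborel (ball y0 r) \<le> 0" using N emeasure_mono by metis
  then have "measure lborel (ball y0 r) = 0" by (simp add: measure_def)
  then show False using content_ball_pos[OF r(1), of y0] by simp
qed

lemma smooth_on_imp_differentiable: "smooth_on S f \<Longrightarrow> y \<in> S \<Longrightarrow> f differentiable (at y)"
  using Cn_on_Suc_has_derivative[of 0 S f y] unfolding smooth_on_def differentiable_def by blast

lemma smooth_on_imp_continuous_on: "smooth_on S f \<Longrightarrow> continuous_on S f"
  unfolding smooth_on_def using Cn_on_imp_continuous_on by blast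

lemma continuous_on_partial: "smooth_on UNIV f \<Longrightarrow> continuous_on S (partial \<alpha> f)"
proof -
  assume "smooth_on UNIV f"
  then have "Cn_on (Suc 0) UNIV f" unfolding smooth_on_def by blast
  then have "continuous_on UNIV (\<lambda>y. frechet_derivative f (at y) (axis \<alpha> 1))"
    by simp
  then show ?thesis unfolding partial_def[abs_def] by (rule continuous_on_subset) simp
qed

text \<open>
  The form is evaluated on \<open>a e\<^sub>i\<close> and \<open>b e\<^sub>j\<close> with real functions \<open>a\<close> and \<open>b\<close>. In the
  difference \<open>S(u,v) - cnj S(v,u)\<close> the first order part involves \<open>a b\<^sub>x - a\<^sub>x b\<close> only, so that a
  suitable choice of \<open>a\<close> and \<open>b\<close> isolates each coefficient without integration by parts.
\<close>

lemma hermitian_form_tested: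
  fixes \<A> :: "'m::t2_space chart set" and a b :: "real^4 \<Rightarrow> real"
  assumes \<A>: "smooth_structure \<A>" and c: "c \<in> \<A>"
    and rep: "canonical_representation \<A> S E F" and herm: "hermitian_form \<A> S"
    and a: "smooth_on UNIV a" and b: "smooth_on UNIV b"
    and K: "compact K" "K \<subseteq> coord c ` domc c"
    and out: "\<And>y. y \<notin> K \<Longrightarrow> a y = 0" "\<And>y. y \<notin> K \<Longrightarrow> b y = 0"
  shows "(LINT y:(coord c ` domc c)|lborel.
      (\<Sum>\<alpha>\<in>UNIV. of_real (a y * partial \<alpha> b y - partial \<alpha> a y * b y) *
          (- (\<i> / 2) * (E c \<alpha> (point c y) $ i $ j - cnj (E c \<alpha> (point c y) $ j $ i)))) +
      of_real (a y * b y) * (F c (point c y) $ i $ j - cnj (F c (point c y) $ j $ i))) = 0"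
proof -
  let ?\<Omega> = "coord c ` domc c"
  let ?u = "extend_by_zero c (\<lambda>y. a y *\<^sub>R axis i 1 :: complex^2)"
  let ?v = "extend_by_zero c (\<lambda>y. b y *\<^sub>R axis j 1 :: complex^2)"
  let ?A = "\<lambda>c \<alpha> x. cscale (- (\<i> / 2)) (E c \<alpha> x)" and ?B = "\<lambda>c \<alpha> x. cscale (\<i> / 2) (E c \<alpha> x)"
  have chart: "is_chart c" using \<A> c by (simp add: smooth_structure_def)
  note C = chart_inverse[OF chart]
  have smooth: "smooth_on UNIV (\<lambda>y. f y *\<^sub>R e)" if "smooth_on UNIV f"
    for f :: "real^4 \<Rightarrow> real" and e :: "complex^2"
    using that Cn_on_bounded_linear[OF bounded_linear_scaleR_left open_UNIV] unfolding smooth_on_def by blast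
  have u: "?u \<in> test_functions \<A>" and v: "?v \<in> test_functions \<A>"
    using out by (auto intro!: test_function_extend_by_zero[OF \<A> c _ K] smooth a b)
  have E: "continuous_on ?\<Omega> (\<lambda>y. E c \<alpha> (point c y))" for \<alpha>
    using rep c smooth_on_imp_continuous_on unfolding canonical_representation_def smooth_vector_density_def comp_def
    by blast
  have F: "continuous_on ?\<Omega> (\<lambda>y. F c (point c y))"
    using rep c smooth_on_imp_continuous_on unfolding canonical_representation_def smooth_density_def comp_def
    by blast
  define h where "h a b i j y =
      (\<Sum>\<alpha>\<in>UNIV. of_real (a y * partial \<alpha> b y) * (- (\<i> / 2) * E c \<alpha> (point c y) $ i $ j)) +
      (\<Sum>\<alpha>\<in>UNIV. of_real (partial \<alpha> a y * b y) * (\<i> / 2 * E c \<alpha> (point c y) $ i $ j)) +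
      of_real (a y * b y) * F c (point c y) $ i $ j"
    for a b :: "real^4 \<Rightarrow> real" and i j :: 2 and y
  have S: "S (extend_by_zero c (\<lambda>y. a y *\<^sub>R axis i 1)) (extend_by_zero c (\<lambda>y. b y *\<^sub>R axis j 1)) =
      (LINT y:?\<Omega>|lborel. h a b i j y)"
    if "extend_by_zero c (\<lambda>y. a y *\<^sub>R axis i 1 :: complex^2) \<in> test_functions \<A>"
      "extend_by_zero c (\<lambda>y. b y *\<^sub>R axis j 1 :: complex^2) \<in> test_functions \<A>"
      "smooth_on UNIV a" "smooth_on UNIV b" for a b :: "real^4 \<Rightarrow> real" and i j :: 2
  proof -
    let ?u = "extend_by_zero c (\<lambda>y. a y *\<^sub>R axis i 1 :: complex^2)"
    let ?v = "extend_by_zero c (\<lambda>y. b y *\<^sub>R axis j 1 :: complex^2)"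
    have "has_density_integral \<A> (form_density ?A ?B F ?u ?v) (S ?u ?v)"
      using rep that(1,2) by (simp add: canonical_representation_def represents_def)
    then have "S ?u ?v = (LINT y:?\<Omega>|lborel. form_density ?A ?B F ?u ?v c (point c y))"
      by (intro density_integral_in_chart[OF \<A> c]) (simp_all add: extend_by_zero_def)
    also have "\<dots> = (LINT y:?\<Omega>|lborel. h a b i j y)"
    proof (rule set_lebesgue_integral_cong)
      show "?\<Omega> \<in> sets lborel" using C(5) by simp
      show "\<forall>y. y \<in> ?\<Omega> \<longrightarrow> form_density ?A ?B F ?u ?v c (point c y) = h a b i j y"
        using form_density_extend_by_zero[OF chart _ that(3,4)[THEN smooth_on_imp_differentiable[OF _ UNIV_I]], of _ ?A ?B F i j]
        by (simp add: h_def cscale_def)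
    qed
    finally show ?thesis .
  qed
  have int: "set_integrable lborel ?\<Omega> (h a b i j)" if "smooth_on UNIV a" "smooth_on UNIV b"
    "\<And>y. y \<notin> K \<Longrightarrow> a y = 0" "\<And>y. y \<notin> K \<Longrightarrow> b y = 0" for a b i j
  proof (rule set_integrable_compact_support[OF C(5) K])
    note cont = that(1,2)[THEN smooth_on_imp_continuous_on, THEN continuous_on_subset, OF subset_UNIV]
    show "continuous_on ?\<Omega> (h a b i j)"
      unfolding h_def
      by (intro continuous_intros E F continuous_on_partial that(1,2) cont)
  qed (simp add: h_def that)
  have cnj_int: "cnj (LINT y:?\<Omega>|lborel. h b a j i y) = (LINT y:?\<Omega>|lborel. cnj (h b a j i y))"
    unfolding set_lebesgue_integral_def by (subst Bochner_Integration.integral_cnj[symmetric]) simp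
  have int_cnj: "set_integrable lborel ?\<Omega> (\<lambda>y. cnj (h b a j i y))"
    using int[OF b a out(2,1), of j i] complex_integrable_cnj[of lborel "\<lambda>y. indicator ?\<Omega> y *\<^sub>R h b a j i y"]
    by (simp add: set_integrable_def)
  have "S ?u ?v = cnj (S ?v ?u)"
    using herm u v unfolding hermitian_form_def by blast
  then have "0 = S ?u ?v - cnj (S ?v ?u)" by simp
  also have "\<dots> = (LINT y:?\<Omega>|lborel. h a b i j y) - (LINT y:?\<Omega>|lborel. cnj (h b a j i y))"
    by (simp only: S[OF u v a b] S[OF v u b a] cnj_int)
  also have "\<dots> = (LINT y:?\<Omega>|lborel. h a b i j y - cnj (h b a j i y))"
    by (rule set_integral_diff(2)[OF int[OF a b out] int_cnj, symmetric])
  also have "(\<lambda>y. h a b i j y - cnj (h b a j i y)) = (\<lambda>y.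
      (\<Sum>\<alpha>\<in>UNIV. of_real (a y * partial \<alpha> b y - partial \<alpha> a y * b y) *
          (- (\<i> / 2) * (E c \<alpha> (point c y) $ i $ j - cnj (E c \<alpha> (point c y) $ j $ i)))) +
      of_real (a y * b y) * (F c (point c y) $ i $ j - cnj (F c (point c y) $ j $ i)))"
    unfolding h_def by (rule ext) (simp add: sum_4 algebra_simps)
  finally show ?thesis by (rule sym)
qed

text \<open>
  With the same bump function \<open>\<psi>\<close> in both slots, the first order part drops out and the zeroth order
  coefficient is integrated against \<open>\<psi>\<^sup>2\<close>. With \<open>\<psi>\<close> and \<open>x\<^sup>\<alpha> \<psi>\<close> in the two slots,
  \<open>a b\<^sub>x - a\<^sub>x b\<close> is \<open>\<psi>\<^sup>2\<close> in the direction \<open>\<alpha>\<close> and \<open>0\<close> in the other directions.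
\<close>

lemma hermitian_coefficients:
  fixes \<A> :: "'m::t2_space chart set"
  assumes \<A>: "smooth_structure \<A>" and c: "c \<in> \<A>" and x: "x \<in> domc c"
    and rep: "canonical_representation \<A> S E F" and herm: "hermitian_form \<A> S"
  shows "ctranspose (E c \<alpha> x) = E c \<alpha> x" and "ctranspose (F c x) = F c x"
proof -
  let ?\<Omega> = "coord c ` domc c"
  have chart: "is_chart c" using \<A> c by (simp add: smooth_structure_def)
  note C = chart_inverse[OF chart]
  define D where "D \<alpha> i j y = - (\<i> / 2) * (E c \<alpha> (point c y) $ i $ j - cnj (E c \<alpha> (point c y) $ j $ i))" for \<alpha> i j y
  define G where "G i j y = F c (point c y) $ i $ j - cnj (F c (point c y) $ j $ i)" for i j y
  have contE: "continuous_on ?\<Omega> (\<lambda>y. E c \<alpha> (point c y))" for \<alpha>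
    using rep c smooth_on_imp_continuous_on unfolding canonical_representation_def smooth_vector_density_def comp_def
    by blast
  have contF: "continuous_on ?\<Omega> (\<lambda>y. F c (point c y))"
    using rep c smooth_on_imp_continuous_on unfolding canonical_representation_def smooth_density_def comp_def
    by blast
  have tested: "(LINT y:?\<Omega>|lborel.
      (\<Sum>\<alpha>\<in>UNIV. of_real (a y * partial \<alpha> b y - partial \<alpha> a y * b y) * D \<alpha> i j y) + of_real (a y * b y) * G i j y) = 0"
    if "smooth_on UNIV a" "smooth_on UNIV b" "compact K" "K \<subseteq> ?\<Omega>"
      "\<And>y. y \<notin> K \<Longrightarrow> a y = 0" "\<And>y. y \<notin> K \<Longrightarrow> b y = 0" for a b K i j
    unfolding D_def G_def by (rule hermitian_form_tested[OF \<A> c rep herm that])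
  have \<psi>: "smooth_on UNIV (bump m r)" for m :: "real^4" and r
    by (simp add: smooth_on_def Cn_on_bump)
  have out: "bump m r y = 0" if "r > 0" "y \<notin> cball m r" for m y :: "real^4" and r
    using that by (intro bump_eq_0) (auto simp: dist_norm norm_minus_commute)
  have G0: "G i j y = 0" if "y \<in> ?\<Omega>" for i j y
  proof (rule continuous_eq_0_if_bump_integrals_0[OF C(5) _ _ that])
    show "continuous_on ?\<Omega> (G i j)" unfolding G_def by (intro continuous_intros contF)
    show "(LINT y:?\<Omega>|lborel. of_real ((bump m r y)\<^sup>2) * G i j y) = 0" if "r > 0" "cball m r \<subseteq> ?\<Omega>" for m r
      using tested[OF \<psi>[of m r] \<psi>[of m r] compact_cball that(2), of i j] out[OF that(1)]
      by (simp add: power2_eq_square mult.commute)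
  qed
  have D0: "D \<alpha> i j y = 0" if "y \<in> ?\<Omega>" for \<alpha> i j y
  proof (rule continuous_eq_0_if_bump_integrals_0[OF C(5) _ _ that])
    show "continuous_on ?\<Omega> (D \<alpha> i j)" unfolding D_def by (intro continuous_intros contE)
    fix m :: "real^4" and r :: real assume r: "r > 0" "cball m r \<subseteq> ?\<Omega>"
    \<comment> \<open>Here \<open>?b\<close> is the bump function times a coordinate, so that \<open>a b\<^sub>x - a\<^sub>x b\<close> loses the derivatives of the bump.\<close>
    let ?a = "bump m r" and ?b = "\<lambda>y. y $ \<alpha> * bump m r y"
    have b: "smooth_on UNIV ?b"
      using \<psi>[of m r] Cn_on_linear[OF bounded_linear_vec_nth open_UNIV]
        Cn_on_bilinear[OF bounded_bilinear_mult open_UNIV] unfolding smooth_on_def by blast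
    have pb: "partial \<beta> ?b y = (if \<beta> = \<alpha> then ?a y else 0) + y $ \<alpha> * partial \<beta> ?a y" for \<beta> y
    proof -
      have "(?b has_derivative (\<lambda>h. y $ \<alpha> * frechet_derivative ?a (at y) h + h $ \<alpha> * ?a y)) (at y)"
        using smooth_on_imp_differentiable[OF \<psi>[of m r] UNIV_I, of y]
        by (intro has_derivative_mult bounded_linear_imp_has_derivative[OF bounded_linear_vec_nth])
          (simp add: frechet_derivative_works)
      from frechet_derivative_at[OF this, symmetric] show ?thesis
        by (simp add: partial_def axis_def)
    qed
    have "(\<Sum>\<beta>\<in>UNIV. complex_of_real (?a y * partial \<beta> ?b y - partial \<beta> ?a y * ?b y) * D \<beta> i j y) =
        of_real ((?a y)\<^sup>2) * D \<alpha> i j y" for y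
    proof -
      have "?a y * partial \<beta> ?b y - partial \<beta> ?a y * ?b y = (if \<beta> = \<alpha> then (?a y)\<^sup>2 else 0)" for \<beta>
        by (simp add: pb power2_eq_square algebra_simps)
      then show ?thesis
        by (simp add: if_distrib[of of_real] if_distrib[of "\<lambda>t. t * _"] cong: if_cong)
    qed
    moreover have "(LINT y:?\<Omega>|lborel.
        (\<Sum>\<beta>\<in>UNIV. of_real (?a y * partial \<beta> ?b y - partial \<beta> ?a y * ?b y) * D \<beta> i j y) +
        of_real (?a y * ?b y) * G i j y) = 0"
      by (rule tested[OF \<psi> b compact_cball r(2)]) (simp_all add: out[OF r(1)])
    ultimately have "(LINT y:?\<Omega>|lborel. of_real ((?a y)\<^sup>2) * D \<alpha> i j y + of_real (?a y * ?b y) * G i j y) = 0"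
      by (simp only:)
    moreover have "(LINT y:?\<Omega>|lborel. of_real ((?a y)\<^sup>2) * D \<alpha> i j y + of_real (?a y * ?b y) * G i j y) =
        (LINT y:?\<Omega>|lborel. of_real ((?a y)\<^sup>2) * D \<alpha> i j y)"
      using G0 C(5) by (intro set_lebesgue_integral_cong) auto
    ultimately show "(LINT y:?\<Omega>|lborel. of_real ((?a y)\<^sup>2) * D \<alpha> i j y) = 0" by simp
  qed
  have y: "coord c x \<in> ?\<Omega>" "point c (coord c x) = x" using x C(1) by auto
  have "E c \<alpha> x $ i $ j = cnj (E c \<alpha> x $ j $ i)" for i j
    using D0[OF y(1), of \<alpha> i j] by (simp add: D_def y(2))
  then show "ctranspose (E c \<alpha> x) = E c \<alpha> x"
    unfolding ctranspose_def vec_eq_iff vec_lambda_beta by metis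
  have "F c x $ i $ j = cnj (F c x $ j $ i)" for i j
    using G0[OF y(1), of i j] by (simp add: G_def y(2))
  then show "ctranspose (F c x) = F c x"
    unfolding ctranspose_def vec_eq_iff vec_lambda_beta by metis
qed

section \<open>Metric, frame and charges at a point\<close>

text \<open>
  The matrix \<open>m\<close> of the introduction, which is \<open>\<rho>\<close> times the frame.
\<close>

definition coeff_matrix :: "'m vec_coeff \<Rightarrow> 'm chart \<Rightarrow> 'm \<Rightarrow> real^4^4" where
  "coeff_matrix E c x = (\<chi> j \<alpha>. pauli_coord (E c \<alpha> x) $ j)"

definition hermitian_regular_at :: "'m vec_coeff \<Rightarrow> 'm chart \<Rightarrow> 'm \<Rightarrow> bool" where
  "hermitian_regular_at E c x \<longleftrightarrow>
     (\<forall>\<alpha>. ctranspose (E c \<alpha> x) = E c \<alpha> x) \<and> (\<forall>p. p \<noteq> 0 \<longrightarrow> prin_symbol E c x p \<noteq> 0)"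

lemma symmetric_matrix_eq_if_quadratic_eq:
  fixes G H :: "real^'n^'n"
  assumes "transpose G = G" and "transpose H = H" and "\<And>p. p \<bullet> (G *v p) = p \<bullet> (H *v p)"
  shows "G = H"
proof -
  have entry: "axis i 1 \<bullet> (A *v axis j 1) = A $ i $ j" for A :: "real^'n^'n" and i j
    by (simp add: matrix_vector_mult_basis column_def inner_axis' )
  have sym: "A $ j $ i = A $ i $ j" if "transpose A = A" for A :: "real^'n^'n" and i j
  proof -
    have "transpose A $ i $ j = A $ j $ i" by (simp add: transpose_def)
    then show ?thesis by (simp add: that)
  qed
  have "G $ i $ j = H $ i $ j" for i j
    using assms(3)[of "axis i 1 + axis j 1"] assms(3)[of "axis i 1"] assms(3)[of "axis j 1"]
      sym[OF assms(1), of i j] sym[OF assms(2), of i j]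
    by (simp add: matrix_vector_right_distrib inner_add_left inner_add_right entry)
  then show ?thesis by (simp add: vec_eq_iff)
qed

lemma det_scaleR_4: "det (k *\<^sub>R (A :: real^4^4)) = k ^ 4 * det A"
  by (simp add: det_4 power4_eq_xxxx algebra_simps)

lemma prin_symbol_eq_herm:
  assumes "\<And>\<alpha>. ctranspose (E c \<alpha> x) = E c \<alpha> x"
  shows "prin_symbol E c x p = herm (coeff_matrix E c x *v p)"
proof -
  note lin = bounded_linear.linear[OF bounded_linear_herm]
  have "coeff_matrix E c x *v p = (\<Sum>\<alpha>\<in>UNIV. p $ \<alpha> *\<^sub>R pauli_coord (E c \<alpha> x))"
    by (simp add: vec_eq_iff coeff_matrix_def matrix_vector_mult_def mult.commute)
  then show ?thesis
    by (simp add: linear_sum[OF lin] linear_scale[OF lin] herm_pauli_coord assms prin_symbol_def)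
qed

context
  fixes E :: "'m vec_coeff" and c :: "'m chart" and x :: 'm
  assumes reg: "hermitian_regular_at E c x"
begin

lemma prin_symbol_herm: "prin_symbol E c x p = herm (coeff_matrix E c x *v p)"
  using reg by (intro prin_symbol_eq_herm) (auto simp: hermitian_regular_at_def)

lemma det_coeff_matrix: "det (coeff_matrix E c x) \<noteq> 0"
proof -
  have "p = 0" if "coeff_matrix E c x *v p = 0" for p
  proof (rule ccontr)
    assume "p \<noteq> 0"
    then have "prin_symbol E c x p \<noteq> 0" using reg by (auto simp: hermitian_regular_at_def)
    then show False using that linear_0[OF bounded_linear.linear[OF bounded_linear_herm]]
      by (simp add: prin_symbol_herm)
  qed
  then show ?thesis
    by (metis invertible_det_nz invertible_left_inverse matrix_left_invertible_ker)
qed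

lemma det_prin_symbol:
  "det (prin_symbol E c x p) =
     - of_real (p \<bullet> ((transpose (coeff_matrix E c x) ** minkowski ** coeff_matrix E c x) *v p))"
proof -
  let ?M = "coeff_matrix E c x"
  have "(?M *v p) \<bullet> w = p \<bullet> (transpose ?M *v w)" for w
    using dot_lmul_matrix[of p "transpose ?M" w] by (simp add: vector_transpose_matrix)
  then show ?thesis
    by (simp add: prin_symbol_herm det_herm matrix_vector_mul_assoc[symmetric])
qed

lemma metric_density_eq:
  "metric_density E c x = transpose (coeff_matrix E c x) ** minkowski ** coeff_matrix E c x"
  (is "_ = ?G")
  unfolding metric_density_def
proof (rule the_equality)
  have sym: "transpose ?G = ?G"
    by (simp add: matrix_transpose_mul transpose_minkowski matrix_mul_assoc)
  then show "transpose ?G = ?G \<and> (\<forall>p. det (prin_symbol E c x p) = - of_real (p \<bullet> (?G *v p)))"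
    using det_prin_symbol by simp
  fix G assume "transpose G = G \<and> (\<forall>p. det (prin_symbol E c x p) = - of_real (p \<bullet> (G *v p)))"
  then have symG: "transpose G = G" and quad: "p \<bullet> (G *v p) = p \<bullet> (?G *v p)" for p
    by (simp_all add: det_prin_symbol)
  show "G = ?G" by (rule symmetric_matrix_eq_if_quadratic_eq[OF symG sym quad])
qed

lemma rho_pos: "rho E c x > 0"
proof -
  have "det (metric_density E c x) = - (det (coeff_matrix E c x))\<^sup>2"
    by (simp add: metric_density_eq det_mul det_minkowski power2_eq_square)
  then show ?thesis using det_coeff_matrix by (simp add: rho_def)
qed

lemma det_prin_symbol_encoded_metric:
  "det (prin_symbol E c x p) = - of_real ((rho E c x)\<^sup>2 * (p \<bullet> (encoded_metric E c x *v p)))"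
proof -
  have "metric_density E c x *v p = (rho E c x)\<^sup>2 *\<^sub>R (encoded_metric E c x *v p)"
    using rho_pos by (simp add: encoded_metric_def scaleR_matrix_vector_assoc)
  then show ?thesis
    unfolding det_prin_symbol metric_density_eq[symmetric] by simp
qed

lemma frame_eq: "frame E c x = (1 / rho E c x) *\<^sub>R coeff_matrix E c x"
  unfolding frame_def
proof (rule the_equality)
  have sum_eq: "(\<Sum>j\<in>UNIV. \<Sum>\<alpha>\<in>UNIV. (e $ j $ \<alpha> * p $ \<alpha>) *\<^sub>R pauli j) = herm (e *v p)"
    for e :: "real^4^4" and p
    by (simp add: herm_def matrix_vector_mult_def scaleR_sum_left)
  note lin = bounded_linear.linear[OF bounded_linear_herm]
  show "\<forall>p. prin_symbol E c x p = rho E c x *\<^sub>R (\<Sum>j\<in>UNIV. \<Sum>\<alpha>\<in>UNIV.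
      (((1 / rho E c x) *\<^sub>R coeff_matrix E c x) $ j $ \<alpha> * p $ \<alpha>) *\<^sub>R pauli j)"
    using rho_pos unfolding sum_eq
    by (simp add: prin_symbol_herm scaleR_matrix_vector_assoc[symmetric] linear_scale[OF lin])
  fix e assume "\<forall>p. prin_symbol E c x p = rho E c x *\<^sub>R (\<Sum>j\<in>UNIV. \<Sum>\<alpha>\<in>UNIV.
      (e $ j $ \<alpha> * p $ \<alpha>) *\<^sub>R pauli j)"
  then have "herm (coeff_matrix E c x *v p) = herm ((rho E c x *\<^sub>R e) *v p)" for p
    unfolding sum_eq by (simp add: prin_symbol_herm scaleR_matrix_vector_assoc[symmetric] linear_scale[OF lin])
  then have "coeff_matrix E c x *v p = (rho E c x *\<^sub>R e) *v p" for p
    by (simp only: herm_inject)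
  then have "coeff_matrix E c x = rho E c x *\<^sub>R e"
    unfolding matrix_eq by blast
  then show "e = (1 / rho E c x) *\<^sub>R coeff_matrix E c x" using rho_pos by simp
qed

lemma sgn_det_frame: "sgn (det (frame E c x)) = sgn (det (coeff_matrix E c x))"
  using rho_pos by (simp add: frame_eq det_scaleR_4 sgn_mult)

lemma time_vector_inner: "time_vector E c x \<bullet> p = 2 / rho E c x * (coeff_matrix E c x *v p) $ 4"
proof -
  let ?t = "(2 / rho E c x) *\<^sub>R row 4 (coeff_matrix E c x)"
  have row: "?t \<bullet> p = 2 / rho E c x * (coeff_matrix E c x *v p) $ 4" for p
    by (simp add: matrix_vector_mul_component row_def inner_vec_def sum_distrib_left sum_divide_distrib mult_ac)
  have t: "trace (prin_symbol E c x p) / of_real (rho E c x) = of_real (?t \<bullet> p)" for p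
    unfolding row by (simp add: prin_symbol_herm trace_herm)
  have "time_vector E c x = ?t"
    unfolding time_vector_def
  proof (rule the_equality)
    fix s assume "\<forall>p. trace (prin_symbol E c x p) / of_real (rho E c x) = of_real (s \<bullet> p)"
    then have "\<forall>p. s \<bullet> p = ?t \<bullet> p" unfolding t of_real_eq_iff by simp
    then show "s = ?t" using vector_eq_rdot by blast
  qed (use t in blast)
  then show ?thesis using row by simp
qed

lemma sgn_time_vector: "sgn (time_vector E c x \<bullet> p) = sgn ((coeff_matrix E c x *v p) $ 4)"
  using rho_pos by (simp add: time_vector_inner sgn_mult)

end

text \<open>
  A Hermitian matrix whose vector lies inside the future light cone is positive definite:
  completing the square leaves the determinant as coefficient of \<open>\<bar>v\<bar>\<^sup>2\<close>.
\<close>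

lemma hermitian_form_pos:
  fixes u v :: complex
  assumes "a \<bullet> (minkowski *v a) < 0" and "a $ 4 > 0" and "u \<noteq> 0 \<or> v \<noteq> 0"
  shows "Re (cnj u * (herm a $ 1 $ 1 * u + herm a $ 1 $ 2 * v) +
             cnj v * (herm a $ 2 $ 1 * u + herm a $ 2 $ 2 * v)) > 0" (is "?Q > 0")
proof -
  let ?x = "a$4 + a$3" and ?z = "a$4 - a$3"
  have cone: "(a$1)\<^sup>2 + (a$2)\<^sup>2 + (a$3)\<^sup>2 < (a$4)\<^sup>2"
    using assms(1) by (simp add: minkowski_quadratic)
  then have "(a$3)\<^sup>2 < (a$4)\<^sup>2" by (smt (verit) zero_le_power2)
  then have "\<bar>a$3\<bar> < a$4" using assms(2) by (intro power2_less_imp_less[of "\<bar>a$3\<bar>"]) simp_all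
  then have x: "?x > 0" by linarith
  define d where "d = ?x * ?z - ((a$1)\<^sup>2 + (a$2)\<^sup>2)"
  have d: "d > 0" using cone by (simp add: d_def power2_eq_square algebra_simps)
  have eq: "?x * ?Q = (?x * Re u + (a$1 * Re v + a$2 * Im v))\<^sup>2 +
      (?x * Im u + (a$1 * Im v - a$2 * Re v))\<^sup>2 + d * ((Re v)\<^sup>2 + (Im v)\<^sup>2)"
    by (simp add: herm_entries d_def power2_eq_square algebra_simps)
  have "?x * ?Q > 0"
  proof (cases "v = 0")
    case True
    then have "(Re u)\<^sup>2 + (Im u)\<^sup>2 > 0"
      using assms(3) by (simp add: complex_eq_iff sum_power2_gt_zero_iff)
    then have "?x * ?x * ((Re u)\<^sup>2 + (Im u)\<^sup>2) > 0" using x by simp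
    then show ?thesis unfolding eq using True by (simp add: power2_eq_square algebra_simps)
  next
    case False
    then have "(Re v)\<^sup>2 + (Im v)\<^sup>2 > 0"
      by (simp add: complex_eq_iff sum_power2_gt_zero_iff)
    then have "d * ((Re v)\<^sup>2 + (Im v)\<^sup>2) > 0" using d by simp
    then show ?thesis unfolding eq by (smt (verit) zero_le_power2)
  qed
  then show ?thesis using x by (simp add: zero_less_mult_iff)
qed

text \<open>
  The trace of \<open>R\<^sup>* A R\<close> is the sum of the values of the quadratic form of \<open>A\<close> at the two columns of
  \<open>R\<close>, neither of which vanishes.
\<close>

lemma SL2_preserves_time_orientation_pos:
  assumes "a \<bullet> (minkowski *v a) < 0" and "a $ 4 > 0" and "det R = 1"
    and b: "herm b = ctranspose R ** herm a ** R"
  shows "b $ 4 > 0"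
proof -
  have nz: "R$1$1 \<noteq> 0 \<or> R$2$1 \<noteq> 0" "R$1$2 \<noteq> 0 \<or> R$2$2 \<noteq> 0"
    using assms(3) by (auto simp: det_2)
  have "2 * b $ 4 = Re (trace (ctranspose R ** herm a ** R))"
    unfolding b[symmetric] by (simp add: trace_herm)
  also have "\<dots> = Re (cnj (R$1$1) * (herm a $ 1 $ 1 * R$1$1 + herm a $ 1 $ 2 * R$2$1) +
        cnj (R$2$1) * (herm a $ 2 $ 1 * R$1$1 + herm a $ 2 $ 2 * R$2$1)) +
      Re (cnj (R$1$2) * (herm a $ 1 $ 1 * R$1$2 + herm a $ 1 $ 2 * R$2$2) +
        cnj (R$2$2) * (herm a $ 2 $ 1 * R$1$2 + herm a $ 2 $ 2 * R$2$2))"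
    by (simp add: trace_def matrix_matrix_mult_def ctranspose_def sum_2 algebra_simps)
  finally show ?thesis
    using hermitian_form_pos[OF assms(1,2) nz(1)] hermitian_form_pos[OF assms(1,2) nz(2)] by linarith
qed

lemma SL2_preserves_time_orientation:
  assumes neg: "a \<bullet> (minkowski *v a) < 0" and R: "det R = 1"
    and b: "herm b = ctranspose R ** herm a ** R"
  shows "sgn (b $ 4) = sgn (a $ 4)"
proof -
  have "a $ 4 \<noteq> 0" 
  proof
    assume "a $ 4 = 0"
    then have "(a$1)\<^sup>2 + (a$2)\<^sup>2 + (a$3)\<^sup>2 < 0"
      using neg by (simp add: minkowski_quadratic)
    then show False by (smt (verit) zero_le_power2)
  qed
  then consider "a $ 4 > 0" | "(- a) $ 4 > 0" by fastforce
  then show ?thesis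
  proof cases
    case 1
    then show ?thesis using SL2_preserves_time_orientation_pos[OF neg 1 R b] by simp
  next
    case 2
    note lin = linear_neg[OF bounded_linear.linear[OF bounded_linear_herm]]
    have "(- a) \<bullet> (minkowski *v (- a)) < 0" using neg by (simp add: minkowski_quadratic)
    moreover have "herm (- b) = ctranspose R ** herm (- a) ** R"
      by (simp add: lin b matmul.minus_left matmul.minus_right)
    ultimately have "(- b) $ 4 > 0"
      using SL2_preserves_time_orientation_pos[of "- a" R "- b"] 2 R by blast
    then show ?thesis using 2 by simp
  qed
qed

text \<open>
  The situation at one point of one chart, where \<open>R\<close> is a single matrix; all the encoded quantities
  without derivatives are compared here.
\<close>

locale SL_related_at =
  fixes E E' :: "'m vec_coeff" and c :: "'m chart" and x :: 'm and R :: "complex^2^2"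
  assumes reg: "hermitian_regular_at E c x" and reg': "hermitian_regular_at E' c x"
    and det_R: "det R = 1"
    and related: "\<And>p. prin_symbol E' c x p = ctranspose R ** prin_symbol E c x p ** R"
begin

lemma det_prin_symbol_eq: "det (prin_symbol E' c x p) = det (prin_symbol E c x p)"
  by (simp add: related det_mul det_ctranspose det_R)

lemma metric_density_eq: "metric_density E' c x = metric_density E c x"
  by (simp add: metric_density_def det_prin_symbol_eq)

lemma rho_eq: "rho E' c x = rho E c x"
  by (simp add: rho_def metric_density_eq)

lemma encoded_metric_eq: "encoded_metric E' c x = encoded_metric E c x"
  by (simp add: encoded_metric_def metric_density_eq rho_eq)

lemma coeff_eq: "E' c \<alpha> x = ctranspose R ** E c \<alpha> x ** R"
proof -
  have "prin_symbol G c x (axis \<alpha> 1) = G c \<alpha> x" for G :: "'m vec_coeff"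
    by (simp add: prin_symbol_def axis_def if_distrib[of "\<lambda>t. t *\<^sub>R _"] cong: if_cong)
  then show ?thesis using related[of "axis \<alpha> 1"] by simp
qed

lemma det_coeff_matrix_eq: "det (coeff_matrix E' c x) = det (coeff_matrix E c x)"
proof -
  have inv: "R ** adjugate2 R = mat 1" "ctranspose (adjugate2 R) ** ctranspose R = mat 1"
    using SL2_inverse[OF det_R] by (simp_all flip: ctranspose_mult) (simp add: matrix_entries)
  have "Im (trace (E' c 1 x ** adjugate2 (E' c 2 x) ** E' c 3 x ** adjugate2 (E' c 4 x))) =
      Im (trace (E c 1 x ** adjugate2 (E c 2 x) ** E c 3 x ** adjugate2 (E c 4 x)))"
  proof -
    \<comment> \<open>Consecutive products \<open>E adj E\<close> are conjugated by \<open>R\<^sup>*\<close>, so that the trace of the product of two of them is unchanged.\<close>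
    have pair: "E' c \<alpha> x ** adjugate2 (E' c \<beta> x) =
        ctranspose R ** (E c \<alpha> x ** adjugate2 (E c \<beta> x)) ** ctranspose (adjugate2 R)" for \<alpha> \<beta>
    proof -
      have "E' c \<alpha> x ** adjugate2 (E' c \<beta> x) = ctranspose R ** E c \<alpha> x ** (R ** adjugate2 R)
          ** adjugate2 (E c \<beta> x) ** ctranspose (adjugate2 R)"
        by (simp add: coeff_eq adjugate2_mult adjugate2_ctranspose matrix_mul_assoc)
      then show ?thesis by (simp add: inv matrix_mul_assoc)
    qed
    have "E' c 1 x ** adjugate2 (E' c 2 x) ** (E' c 3 x ** adjugate2 (E' c 4 x)) =
        ctranspose R ** (E c 1 x ** adjugate2 (E c 2 x)) ** (ctranspose (adjugate2 R) ** ctranspose R)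
          ** (E c 3 x ** adjugate2 (E c 4 x)) ** ctranspose (adjugate2 R)"
      by (simp add: pair matrix_mul_assoc)
    also have "trace \<dots> = trace (ctranspose (adjugate2 R) ** (ctranspose R **
        (E c 1 x ** adjugate2 (E c 2 x) ** (E c 3 x ** adjugate2 (E c 4 x)))))"
      by (subst trace_mul_sym) (simp add: inv matrix_mul_assoc)
    also have "\<dots> = trace (E c 1 x ** adjugate2 (E c 2 x) ** (E c 3 x ** adjugate2 (E c 4 x)))"
      by (simp add: inv matrix_mul_assoc)
    finally show ?thesis by (simp add: matrix_mul_assoc)
  qed
  moreover have "herm (pauli_coord (G c \<alpha> x)) = G c \<alpha> x" if "hermitian_regular_at G c x"
    for G :: "'m vec_coeff" and \<alpha>
    using that by (simp add: hermitian_regular_at_def herm_pauli_coord)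
  ultimately show ?thesis
    using det_eq_trace_herm[of "\<lambda>\<alpha>. pauli_coord (E c \<alpha> x)"]
      det_eq_trace_herm[of "\<lambda>\<alpha>. pauli_coord (E' c \<alpha> x)"] reg reg'
    by (simp add: coeff_matrix_def)
qed

lemma sgn_det_frame_eq: "sgn (det (frame E' c x)) = sgn (det (frame E c x))"
  by (simp add: sgn_det_frame[OF reg] sgn_det_frame[OF reg'] det_coeff_matrix_eq)

lemma sgn_time_vector_eq:
  assumes "p \<bullet> (encoded_metric E c x *v p) < 0"
  shows "sgn (time_vector E' c x \<bullet> p) = sgn (time_vector E c x \<bullet> p)"
proof -
  let ?a = "coeff_matrix E c x *v p"
  have "- complex_of_real (?a \<bullet> (minkowski *v ?a)) =
      - of_real ((rho E c x)\<^sup>2 * (p \<bullet> (encoded_metric E c x *v p)))"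
    using det_prin_symbol_encoded_metric[OF reg] by (simp add: prin_symbol_herm[OF reg] det_herm)
  then have "?a \<bullet> (minkowski *v ?a) = (rho E c x)\<^sup>2 * (p \<bullet> (encoded_metric E c x *v p))"
    by (simp only: neg_equal_iff_equal of_real_eq_iff)
  then have "?a \<bullet> (minkowski *v ?a) < 0"
    using assms rho_pos[OF reg] by (simp add: mult_pos_neg)
  then have "sgn ((coeff_matrix E' c x *v p) $ 4) = sgn (?a $ 4)"
    using related[of p] by (intro SL2_preserves_time_orientation[OF _ det_R])
      (simp_all add: prin_symbol_herm[OF reg] prin_symbol_herm[OF reg'])
  then show ?thesis by (simp add: sgn_time_vector[OF reg] sgn_time_vector[OF reg'])
qed

end

section \<open>Derivatives in momentum and position\<close>

lemma partial_linear:
  "partial \<alpha> (\<lambda>p. \<Sum>\<beta>\<in>UNIV. p $ \<beta> *\<^sub>R U \<beta>) p = (U \<alpha> :: 'b::real_normed_vector)"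
proof -
  have "bounded_linear (\<lambda>p :: real^4. \<Sum>\<beta>\<in>UNIV. p $ \<beta> *\<^sub>R U \<beta>)"
    by (intro bounded_linear_sum bounded_linear_scaleR_const bounded_linear_vec_nth)
  then have "frechet_derivative (\<lambda>p :: real^4. \<Sum>\<beta>\<in>UNIV. p $ \<beta> *\<^sub>R U \<beta>) (at p) =
      (\<lambda>p. \<Sum>\<beta>\<in>UNIV. p $ \<beta> *\<^sub>R U \<beta>)"
    by (intro frechet_derivative_at[symmetric] bounded_linear_imp_has_derivative)
  then show ?thesis
    by (simp add: partial_def axis_def if_distrib[of "\<lambda>t. t *\<^sub>R _"] cong: if_cong)
qed

lemma partial_const_add:
  assumes "f differentiable (at p)"
  shows "partial \<alpha> (\<lambda>p. f p + k) p = partial \<alpha> f p"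
proof -
  have "((\<lambda>p. f p + k) has_derivative frechet_derivative f (at p)) (at p)"
    using assms frechet_derivative_works has_derivative_add_const by blast
  from frechet_derivative_at[OF this] show ?thesis by (simp add: partial_def)
qed

lemma partial_prin_symbol: "partial \<alpha> (prin_symbol E c x) p = E c \<alpha> x"
  using partial_linear[of \<alpha> "\<lambda>\<alpha>. E c \<alpha> x" p] by (simp add: prin_symbol_def[abs_def])

lemma bounded_linear_prin_symbol: "bounded_linear (prin_symbol E c x)"
  unfolding prin_symbol_def[abs_def]
  by (intro bounded_linear_sum bounded_linear_scaleR_const bounded_linear_vec_nth)

lemma partial_full_symbol: "partial \<alpha> (full_symbol E F c x) p = E c \<alpha> x"
  using partial_const_add[OF bounded_linear_imp_differentiable[OF bounded_linear_prin_symbol]]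
  by (simp add: full_symbol_def[abs_def] partial_prin_symbol)

text \<open>
  The bracket in the definition of the covariant subprincipal symbol is a quadratic form in the
  momentum, and its second momentum derivatives are the symmetrised coefficients.
\<close>

lemma partial_quadratic:
  "partial \<beta> (partial \<alpha> (\<lambda>p. \<Sum>\<mu>\<in>UNIV. \<Sum>\<nu>\<in>UNIV. (p $ \<mu> * p $ \<nu>) *\<^sub>R T \<mu> \<nu>)) p =
     (T \<alpha> \<beta> + T \<beta> \<alpha> :: 'b::real_normed_vector)"
proof -
  have "partial \<alpha> (\<lambda>p. \<Sum>\<mu>\<in>UNIV. \<Sum>\<nu>\<in>UNIV. (p $ \<mu> * p $ \<nu>) *\<^sub>R T \<mu> \<nu>) =
      (\<lambda>p. \<Sum>\<nu>\<in>UNIV. p $ \<nu> *\<^sub>R (T \<alpha> \<nu> + T \<nu> \<alpha>))"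
  proof
    fix p :: "real^4"
    have nth: "((\<lambda>p :: real^4. p $ \<mu>) has_derivative (\<lambda>h. h $ \<mu>)) (at p)" for \<mu>
      by (intro bounded_linear_imp_has_derivative bounded_linear_vec_nth)
    have "((\<lambda>p. \<Sum>\<mu>\<in>UNIV. \<Sum>\<nu>\<in>UNIV. (p $ \<mu> * p $ \<nu>) *\<^sub>R T \<mu> \<nu>) has_derivative
        (\<lambda>h. \<Sum>\<mu>\<in>UNIV. \<Sum>\<nu>\<in>UNIV. (p $ \<mu> * h $ \<nu> + h $ \<mu> * p $ \<nu>) *\<^sub>R T \<mu> \<nu>)) (at p)"
      by (intro has_derivative_sum has_derivative_scaleR_left has_derivative_mult nth)
    note frechet_derivative_at[OF this, THEN fun_cong, of "axis \<alpha> 1", symmetric]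
    then have "partial \<alpha> (\<lambda>p. \<Sum>\<mu>\<in>UNIV. \<Sum>\<nu>\<in>UNIV. (p $ \<mu> * p $ \<nu>) *\<^sub>R T \<mu> \<nu>) p =
        (\<Sum>\<mu>\<in>UNIV. \<Sum>\<nu>\<in>UNIV. (p $ \<mu> * axis \<alpha> 1 $ \<nu> + axis \<alpha> 1 $ \<mu> * p $ \<nu>) *\<^sub>R T \<mu> \<nu>)"
      unfolding partial_def .
    also have "\<dots> = (\<Sum>\<mu>\<in>UNIV. \<Sum>\<nu>\<in>UNIV. (p $ \<mu> * axis \<alpha> 1 $ \<nu>) *\<^sub>R T \<mu> \<nu>) +
        (\<Sum>\<nu>\<in>UNIV. \<Sum>\<mu>\<in>UNIV. (axis \<alpha> 1 $ \<mu> * p $ \<nu>) *\<^sub>R T \<mu> \<nu>)"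
      by (subst (3) sum.swap) (simp add: scaleR_add_left sum.distrib)
    also have "\<dots> = (\<Sum>\<mu>\<in>UNIV. p $ \<mu> *\<^sub>R T \<mu> \<alpha>) + (\<Sum>\<nu>\<in>UNIV. p $ \<nu> *\<^sub>R T \<alpha> \<nu>)"
      by (simp add: axis_def if_distrib[of "\<lambda>t. _ * t"] if_distrib[of "\<lambda>t. t * _"]
          if_distrib[of "\<lambda>t. t *\<^sub>R _"] cong: if_cong)
    finally show "partial \<alpha> (\<lambda>p. \<Sum>\<mu>\<in>UNIV. \<Sum>\<nu>\<in>UNIV. (p $ \<mu> * p $ \<nu>) *\<^sub>R T \<mu> \<nu>) p =
        (\<Sum>\<nu>\<in>UNIV. p $ \<nu> *\<^sub>R (T \<alpha> \<nu> + T \<nu> \<alpha>))"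
      by (simp add: scaleR_add_right sum.distrib add.commute)
  qed
  then show ?thesis by (simp only: partial_linear)
qed

lemma pd_eqI:
  assumes "((f \<circ> point c) has_derivative D) (at (coord c x))"
  shows "pd c \<alpha> f x = D (axis \<alpha> 1)"
  using frechet_derivative_at[OF assms] by (simp add: pd_def partial_def)

abbreviation differentiable_in_chart :: "'m chart \<Rightarrow> ('m \<Rightarrow> 'b::real_normed_vector) \<Rightarrow> 'm \<Rightarrow> bool" where
  "differentiable_in_chart c f x \<equiv> (f \<circ> point c) differentiable (at (coord c x))"

lemma differentiable_bounded_linear:
  assumes "bounded_linear L" and "differentiable_in_chart c f x"
  shows "differentiable_in_chart c (\<lambda>z. L (f z)) x"
  using bounded_linear.has_derivative[OF assms(1)] assms(2)
  unfolding differentiable_def comp_def by blast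

lemma pd_bounded_linear:
  assumes "bounded_linear L" and "differentiable_in_chart c f x"
  shows "pd c \<alpha> (\<lambda>z. L (f z)) x = L (pd c \<alpha> f x)"
proof -
  have "((f \<circ> point c) has_derivative frechet_derivative (f \<circ> point c) (at (coord c x))) (at (coord c x))"
    using assms(2) frechet_derivative_works by blast
  from bounded_linear.has_derivative[OF assms(1) this]
  have "(((\<lambda>z. L (f z)) \<circ> point c) has_derivative
      (\<lambda>h. L (frechet_derivative (f \<circ> point c) (at (coord c x)) h))) (at (coord c x))"
    by (simp add: comp_def)
  from pd_eqI[OF this] show ?thesis by (simp add: pd_def partial_def)
qed

lemma has_derivative_bilinear_in_chart:
  assumes "bounded_bilinear m" and "differentiable_in_chart c f x" and "differentiable_in_chart c g x"
    and "point c (coord c x) = x"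
  shows "(((\<lambda>z. m (f z) (g z)) \<circ> point c) has_derivative
      (\<lambda>h. m (f x) (frechet_derivative (g \<circ> point c) (at (coord c x)) h) +
           m (frechet_derivative (f \<circ> point c) (at (coord c x)) h) (g x))) (at (coord c x))"
  using bounded_bilinear.FDERIV[OF assms(1) assms(2,3)[unfolded frechet_derivative_works]] assms(4)
  by (simp add: comp_def)

lemma differentiable_bilinear:
  assumes "bounded_bilinear m" and "differentiable_in_chart c f x" and "differentiable_in_chart c g x"
    and "point c (coord c x) = x"
  shows "differentiable_in_chart c (\<lambda>z. m (f z) (g z)) x"
  using has_derivative_bilinear_in_chart[OF assms] unfolding differentiable_def by blast

lemma pd_bilinear:
  assumes "bounded_bilinear m" and "differentiable_in_chart c f x" and "differentiable_in_chart c g x"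
    and "point c (coord c x) = x"
  shows "pd c \<alpha> (\<lambda>z. m (f z) (g z)) x = m (pd c \<alpha> f x) (g x) + m (f x) (pd c \<alpha> g x)"
  using pd_eqI[OF has_derivative_bilinear_in_chart[OF assms]] by (simp add: pd_def partial_def)

lemma pd_cong:
  assumes "is_chart c" and "x \<in> domc c" and "\<And>z. z \<in> domc c \<Longrightarrow> f z = g z"
    and "differentiable_in_chart c f x"
  shows "pd c \<alpha> f x = pd c \<alpha> g x"
proof -
  have inv: "point c y \<in> domc c" if "y \<in> coord c ` domc c" for y
    using that by (simp add: point_def inv_into_into)
  have "((g \<circ> point c) has_derivative frechet_derivative (f \<circ> point c) (at (coord c x))) (at (coord c x))"
  proof (rule has_derivative_transform_within_open)
    show "((f \<circ> point c) has_derivative frechet_derivative (f \<circ> point c) (at (coord c x))) (at (coord c x))"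
      using assms(4) frechet_derivative_works by blast
    show "open (coord c ` domc c)" using assms(1) by (simp add: is_chart_def)
  qed (use assms inv in auto)
  from pd_eqI[OF this] show ?thesis by (simp add: pd_def partial_def)
qed

section \<open>Contractions with the inverse metric\<close>

lemma matrix_inv_eqI:
  fixes A B :: "real^'n^'n"
  assumes "A ** B = mat 1"
  shows "matrix_inv A = B"
  unfolding matrix_inv_def
proof (rule some_equality)
  show inv: "A ** B = mat 1 \<and> B ** A = mat 1"
    using assms matrix_left_right_inverse by blast
  fix C assume C: "A ** C = mat 1 \<and> C ** A = mat 1"
  have "C = (B ** A) ** C" using inv by simp
  also have "\<dots> = B ** (A ** C)" by (simp only: matrix_mul_assoc)
  finally show "C = B" using C by simp
qed

text \<open>
  Both identities restate that \<open>\<Sum>\<^sub>j s\<^sup>j X s\<^sup>j = 2 (tr X) Id - X\<close> for the three trace-free Pauli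
  matrices, since the adjugate changes the sign of these three and fixes the identity.
\<close>

lemma sandwich_pauli:
  "(\<Sum>j\<in>UNIV. \<Sum>k\<in>UNIV. minkowski $ j $ k *\<^sub>R (pauli j ** X ** adjugate2 (pauli k))) =
     cscale (- 2 * trace X) (mat 1)"
  "(\<Sum>j\<in>UNIV. \<Sum>k\<in>UNIV. minkowski $ j $ k *\<^sub>R (adjugate2 (pauli j) ** X ** pauli k)) =
     cscale (- 2 * trace X) (mat 1)"
  by (simp_all add: sum_4 minkowski_def pauli_def matrix_entries algebra_simps)

context
  fixes E :: "'m vec_coeff" and c :: "'m chart" and x :: 'm
  assumes reg: "hermitian_regular_at E c x"
begin

lemma coeff_matrix_metric_inverse:
  "coeff_matrix E c x ** matrix_inv (metric_density E c x) ** transpose (coeff_matrix E c x) = minkowski"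
  "transpose (matrix_inv (metric_density E c x)) = matrix_inv (metric_density E c x)"
proof -
  let ?M = "coeff_matrix E c x"
  obtain N where N: "?M ** N = mat 1" "N ** ?M = mat 1"
    using det_coeff_matrix[OF reg] by (metis invertible_det_nz invertible_def)
  \<comment> \<open>The inverse of \<open>m\<^sup>T \<eta> m\<close> is \<open>m\<^sup>-\<^sup>1 \<eta> m\<^sup>-\<^sup>T\<close>, as \<open>\<eta>\<close> is an involution.\<close>
  have Nt: "transpose N ** transpose ?M = mat 1" "transpose ?M ** transpose N = mat 1"
    using N by (simp_all add: transpose_mat flip: matrix_transpose_mul)
  have "metric_density E c x ** (N ** minkowski ** transpose N) =
      transpose ?M ** minkowski ** (?M ** N) ** minkowski ** transpose N"
    by (simp add: metric_density_eq[OF reg] matrix_mul_assoc)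
  also have "\<dots> = transpose ?M ** (minkowski ** minkowski) ** transpose N"
    by (simp add: N matrix_mul_assoc)
  finally have 1: "metric_density E c x ** (N ** minkowski ** transpose N) = mat 1"
    by (simp add: minkowski_square Nt)
  then have inv: "matrix_inv (metric_density E c x) = N ** minkowski ** transpose N"
    by (rule matrix_inv_eqI)
  have "?M ** (N ** minkowski ** transpose N) ** transpose ?M =
      (?M ** N) ** minkowski ** (transpose N ** transpose ?M)"
    by (simp only: matrix_mul_assoc)
  then show "?M ** matrix_inv (metric_density E c x) ** transpose ?M = minkowski"
    by (simp add: inv N Nt)
  show "transpose (matrix_inv (metric_density E c x)) = matrix_inv (metric_density E c x)"
    by (simp add: inv matrix_transpose_mul transpose_minkowski matrix_mul_assoc)
qed

text \<open>
  Contraction with the inverse metric density undoes the change of basis from the Pauli matrices to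
  the coefficients \<open>E\<^sup>\<alpha>\<close>, because \<open>m (m\<^sup>T \<eta> m)\<^sup>-\<^sup>1 m\<^sup>T = \<eta>\<close>. Hence every bilinear contraction can be
  computed with the Pauli matrices.
\<close>

lemma metric_contraction:
  assumes "bounded_bilinear (B :: complex^2^2 \<Rightarrow> complex^2^2 \<Rightarrow> complex^2^2)"
  shows "(\<Sum>\<alpha>\<in>UNIV. \<Sum>\<beta>\<in>UNIV. (matrix_inv (metric_density E c x) $ \<alpha> $ \<beta>) *\<^sub>R B (E c \<alpha> x) (E c \<beta> x)) =
    (\<Sum>j\<in>UNIV. \<Sum>k\<in>UNIV. minkowski $ j $ k *\<^sub>R B (pauli j) (pauli k))"
proof -
  interpret B: bounded_bilinear B by fact
  let ?M = "coeff_matrix E c x" and ?g = "matrix_inv (metric_density E c x)"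
  have E: "E c \<alpha> x = (\<Sum>j\<in>UNIV. ?M $ j $ \<alpha> *\<^sub>R pauli j)" for \<alpha>
    using herm_pauli_coord[of "E c \<alpha> x"] reg
    by (simp add: hermitian_regular_at_def coeff_matrix_def herm_def)
  have "(\<Sum>\<alpha>\<in>UNIV. \<Sum>\<beta>\<in>UNIV. ?g $ \<alpha> $ \<beta> *\<^sub>R B (E c \<alpha> x) (E c \<beta> x)) =
      (\<Sum>\<alpha>\<in>UNIV. \<Sum>\<beta>\<in>UNIV. \<Sum>j\<in>UNIV. \<Sum>k\<in>UNIV. (?M $ j $ \<alpha> * ?g $ \<alpha> $ \<beta> * ?M $ k $ \<beta>) *\<^sub>R B (pauli j) (pauli k))"
    unfolding E B.sum_left
    by (simp add: B.sum_right B.scaleR_left B.scaleR_right scaleR_sum_right mult_ac)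
  also have "\<dots> = (\<Sum>j\<in>UNIV. \<Sum>k\<in>UNIV. \<Sum>\<beta>\<in>UNIV. \<Sum>\<alpha>\<in>UNIV. (?M $ j $ \<alpha> * ?g $ \<alpha> $ \<beta> * ?M $ k $ \<beta>) *\<^sub>R B (pauli j) (pauli k))"
    (is "sum ?f _ = _")
  proof -
    let ?t = "\<lambda>\<alpha> \<beta> j k. (?M $ j $ \<alpha> * ?g $ \<alpha> $ \<beta> * ?M $ k $ \<beta>) *\<^sub>R B (pauli j) (pauli k)"
    have "(\<Sum>\<alpha>\<in>UNIV. \<Sum>\<beta>\<in>UNIV. \<Sum>j\<in>UNIV. \<Sum>k\<in>UNIV. ?t \<alpha> \<beta> j k) = (\<Sum>\<alpha>\<in>UNIV. \<Sum>j\<in>UNIV. \<Sum>\<beta>\<in>UNIV. \<Sum>k\<in>UNIV. ?t \<alpha> \<beta> j k)"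
      by (rule sum.cong[OF refl], rule sum.swap)
    also have "\<dots> = (\<Sum>j\<in>UNIV. \<Sum>\<alpha>\<in>UNIV. \<Sum>\<beta>\<in>UNIV. \<Sum>k\<in>UNIV. ?t \<alpha> \<beta> j k)"
      by (rule sum.swap)
    also have "\<dots> = (\<Sum>j\<in>UNIV. \<Sum>\<alpha>\<in>UNIV. \<Sum>k\<in>UNIV. \<Sum>\<beta>\<in>UNIV. ?t \<alpha> \<beta> j k)"
      by (rule sum.cong[OF refl], rule sum.cong[OF refl], rule sum.swap)
    also have "\<dots> = (\<Sum>j\<in>UNIV. \<Sum>k\<in>UNIV. \<Sum>\<alpha>\<in>UNIV. \<Sum>\<beta>\<in>UNIV. ?t \<alpha> \<beta> j k)"
      by (rule sum.cong[OF refl], rule sum.swap)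
    also have "\<dots> = (\<Sum>j\<in>UNIV. \<Sum>k\<in>UNIV. \<Sum>\<beta>\<in>UNIV. \<Sum>\<alpha>\<in>UNIV. ?t \<alpha> \<beta> j k)"
      by (rule sum.cong[OF refl], rule sum.cong[OF refl], rule sum.swap)
    finally show ?thesis .
  qed
  also have "\<dots> = (\<Sum>j\<in>UNIV. \<Sum>k\<in>UNIV. (?M ** ?g ** transpose ?M) $ j $ k *\<^sub>R B (pauli j) (pauli k))"
    by (simp add: matrix_matrix_mult_def transpose_def scaleR_sum_left sum_distrib_right)
  finally show ?thesis by (simp only: coeff_matrix_metric_inverse)
qed

lemma sandwich_contraction:
  "(\<Sum>\<alpha>\<in>UNIV. \<Sum>\<beta>\<in>UNIV. (matrix_inv (metric_density E c x) $ \<alpha> $ \<beta>) *\<^sub>R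
      (E c \<alpha> x ** X ** adjugate2 (E c \<beta> x))) = cscale (- 2 * trace X) (mat 1)"
  "(\<Sum>\<alpha>\<in>UNIV. \<Sum>\<beta>\<in>UNIV. (matrix_inv (metric_density E c x) $ \<alpha> $ \<beta>) *\<^sub>R
      (adjugate2 (E c \<beta> x) ** X ** E c \<alpha> x)) = cscale (- 2 * trace X) (mat 1)"
proof -
  have 1: "bounded_bilinear (\<lambda>A B. A ** X ** adjugate2 B)"
    unfolding bilinear_conv_bounded_bilinear[symmetric] bilinear_def
    by (intro conjI allI linearI) (simp_all add: matrix_entries algebra_simps)
  have 2: "bounded_bilinear (\<lambda>A B. adjugate2 B ** X ** A)"
    unfolding bilinear_conv_bounded_bilinear[symmetric] bilinear_def
    by (intro conjI allI linearI) (simp_all add: matrix_entries algebra_simps)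
  show "(\<Sum>\<alpha>\<in>UNIV. \<Sum>\<beta>\<in>UNIV. (matrix_inv (metric_density E c x) $ \<alpha> $ \<beta>) *\<^sub>R
      (E c \<alpha> x ** X ** adjugate2 (E c \<beta> x))) = cscale (- 2 * trace X) (mat 1)"
    unfolding metric_contraction[OF 1] by (rule sandwich_pauli)
  have "minkowski $ k $ j = minkowski $ j $ k" for j k by (simp add: minkowski_def)
  then show "(\<Sum>\<alpha>\<in>UNIV. \<Sum>\<beta>\<in>UNIV. (matrix_inv (metric_density E c x) $ \<alpha> $ \<beta>) *\<^sub>R
      (adjugate2 (E c \<beta> x) ** X ** E c \<alpha> x)) = cscale (- 2 * trace X) (mat 1)"
    unfolding metric_contraction[OF 2] sandwich_pauli(2)[of X, symmetric]
    by (subst sum.swap) simp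
qed

end

section \<open>Covariance of the covariant subprincipal symbol\<close>

lemma pd_prin_symbol:
  assumes "\<And>\<beta>. differentiable_in_chart c (E c \<beta>) x"
  shows "pd c \<gamma> (\<lambda>z. prin_symbol E c z p) x = prin_symbol (\<lambda>c \<beta>. pd c \<gamma> (E c \<beta>)) c x p"
proof -
  have "((\<lambda>y. \<Sum>\<beta>\<in>UNIV. p $ \<beta> *\<^sub>R (E c \<beta> \<circ> point c) y) has_derivative
      (\<lambda>h. \<Sum>\<beta>\<in>UNIV. p $ \<beta> *\<^sub>R frechet_derivative (E c \<beta> \<circ> point c) (at (coord c x)) h)) (at (coord c x))"
    using assms[unfolded frechet_derivative_works]
    by (intro has_derivative_sum has_derivative_scaleR_right) (simp add: comp_def)
  then have "(((\<lambda>z. prin_symbol E c z p) \<circ> point c) has_derivative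
      (\<lambda>h. \<Sum>\<beta>\<in>UNIV. p $ \<beta> *\<^sub>R frechet_derivative (E c \<beta> \<circ> point c) (at (coord c x)) h)) (at (coord c x))"
    by (simp add: prin_symbol_def comp_def)
  from pd_eqI[OF this] show ?thesis by (simp add: prin_symbol_def pd_def partial_def)
qed

lemma adjugate2_prin_symbol: "adjugate2 (prin_symbol E c x p) = prin_symbol (\<lambda>c \<beta> x. adjugate2 (E c \<beta> x)) c x p"
  by (simp add: prin_symbol_def adjugate2_linear)

text \<open>
  The coefficient of \<open>p\<^sub>\<mu> p\<^sub>\<nu>\<close> in the \<open>\<gamma>\<close>-th summand of the generalised Poisson bracket.
\<close>

definition bracket_coeff :: "'m vec_coeff \<Rightarrow> 'm chart \<Rightarrow> 'm \<Rightarrow> 4 \<Rightarrow> 4 \<Rightarrow> 4 \<Rightarrow> complex^2^2" where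
  "bracket_coeff E c x \<gamma> \<mu> \<nu> =
     pd c \<gamma> (E c \<mu>) x ** adjugate2 (E c \<nu> x) ** E c \<gamma> x -
     E c \<gamma> x ** adjugate2 (E c \<nu> x) ** pd c \<gamma> (E c \<mu>) x"

lemma poisson3_prin_symbol:
  assumes "\<And>\<beta>. differentiable_in_chart c (E c \<beta>) x"
  shows "poisson3 c (prin_symbol E c) (\<lambda>z p. adjugate2 (prin_symbol E c z p)) (prin_symbol E c) x p =
    (\<Sum>\<mu>\<in>UNIV. \<Sum>\<nu>\<in>UNIV. (p $ \<mu> * p $ \<nu>) *\<^sub>R (\<Sum>\<gamma>\<in>UNIV. bracket_coeff E c x \<gamma> \<mu> \<nu>))"
proof -
  have "pd c \<gamma> (\<lambda>z. prin_symbol E c z p) x ** adjugate2 (prin_symbol E c x p) ** E c \<gamma> x -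
      E c \<gamma> x ** adjugate2 (prin_symbol E c x p) ** pd c \<gamma> (\<lambda>z. prin_symbol E c z p) x =
      (\<Sum>\<mu>\<in>UNIV. \<Sum>\<nu>\<in>UNIV. (p $ \<mu> * p $ \<nu>) *\<^sub>R bracket_coeff E c x \<gamma> \<mu> \<nu>)" for \<gamma>
  proof -
    let ?D = "\<lambda>\<mu>. pd c \<gamma> (E c \<mu>) x" and ?a = "\<lambda>\<nu>. adjugate2 (E c \<nu> x)"
    have "(\<Sum>\<mu>\<in>UNIV. p $ \<mu> *\<^sub>R ?D \<mu>) ** (\<Sum>\<nu>\<in>UNIV. p $ \<nu> *\<^sub>R ?a \<nu>) ** E c \<gamma> x =
        (\<Sum>\<mu>\<in>UNIV. \<Sum>\<nu>\<in>UNIV. (p $ \<mu> * p $ \<nu>) *\<^sub>R (?D \<mu> ** ?a \<nu> ** E c \<gamma> x))"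
      unfolding matmul.sum_left
      by (simp add: matmul.sum_right matmul.sum_left matmul.scaleR_left matmul.scaleR_right scaleR_sum_right mult.commute)
    moreover have "E c \<gamma> x ** (\<Sum>\<nu>\<in>UNIV. p $ \<nu> *\<^sub>R ?a \<nu>) ** (\<Sum>\<mu>\<in>UNIV. p $ \<mu> *\<^sub>R ?D \<mu>) =
        (\<Sum>\<mu>\<in>UNIV. \<Sum>\<nu>\<in>UNIV. (p $ \<mu> * p $ \<nu>) *\<^sub>R (E c \<gamma> x ** ?a \<nu> ** ?D \<mu>))"
      unfolding matmul.sum_right
      by (simp add: matmul.sum_left matmul.sum_right matmul.scaleR_left matmul.scaleR_right scaleR_sum_right)
    ultimately show ?thesis
      using pd_prin_symbol[where E = E and c = c and x = x and \<gamma> = \<gamma> and p = p] assms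
      by (simp add: adjugate2_prin_symbol)
         (simp add: prin_symbol_def bracket_coeff_def scaleR_diff_right sum_subtractf)
  qed
  then have "poisson3 c (prin_symbol E c) (\<lambda>z p. adjugate2 (prin_symbol E c z p)) (prin_symbol E c) x p =
      (\<Sum>\<gamma>\<in>UNIV. \<Sum>\<mu>\<in>UNIV. \<Sum>\<nu>\<in>UNIV. (p $ \<mu> * p $ \<nu>) *\<^sub>R bracket_coeff E c x \<gamma> \<mu> \<nu>)"
    by (simp add: poisson3_def partial_prin_symbol)
  also have "\<dots> = (\<Sum>\<mu>\<in>UNIV. \<Sum>\<gamma>\<in>UNIV. \<Sum>\<nu>\<in>UNIV. (p $ \<mu> * p $ \<nu>) *\<^sub>R bracket_coeff E c x \<gamma> \<mu> \<nu>)"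
    by (rule sum.swap)
  also have "\<dots> = (\<Sum>\<mu>\<in>UNIV. \<Sum>\<nu>\<in>UNIV. \<Sum>\<gamma>\<in>UNIV. (p $ \<mu> * p $ \<nu>) *\<^sub>R bracket_coeff E c x \<gamma> \<mu> \<nu>)"
    by (rule sum.cong[OF refl], rule sum.swap)
  finally show ?thesis by (simp only: scaleR_sum_right)
qed

definition contracted_bracket :: "'m vec_coeff \<Rightarrow> 'm chart \<Rightarrow> 'm \<Rightarrow> 4 \<Rightarrow> complex^2^2" where
  "contracted_bracket E c x \<gamma> = (\<Sum>\<mu>\<in>UNIV. \<Sum>\<nu>\<in>UNIV.
     (matrix_inv (metric_density E c x) $ \<mu> $ \<nu>) *\<^sub>R bracket_coeff E c x \<gamma> \<mu> \<nu>)"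

text \<open>
  The factor \<open>1/16\<close> becomes \<open>1/8\<close> because the second momentum derivative symmetrises the
  coefficients while the inverse metric is already symmetric.
\<close>

lemma csub_symbol_eq:
  assumes reg: "hermitian_regular_at E c x" and diff: "\<And>\<beta>. differentiable_in_chart c (E c \<beta>) x"
  shows "csub_symbol E F c x = F c x + cscale (\<i> / 8) (\<Sum>\<gamma>\<in>UNIV. contracted_bracket E c x \<gamma>)"
proof -
  let ?g = "matrix_inv (metric_density E c x)"
  let ?T = "\<lambda>\<mu> \<nu>. \<Sum>\<gamma>\<in>UNIV. bracket_coeff E c x \<gamma> \<mu> \<nu>"
  have sym: "?g $ \<nu> $ \<mu> = ?g $ \<mu> $ \<nu>" for \<mu> \<nu>
  proof -
    have "transpose ?g $ \<mu> $ \<nu> = ?g $ \<nu> $ \<mu>" by (simp add: transpose_def)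
    then show ?thesis by (simp add: coeff_matrix_metric_inverse(2)[OF reg])
  qed
  have "poisson3 c (prin_symbol E c) (\<lambda>z p. adjugate2 (prin_symbol E c z p)) (prin_symbol E c) x =
      (\<lambda>p. \<Sum>\<mu>\<in>UNIV. \<Sum>\<nu>\<in>UNIV. (p $ \<mu> * p $ \<nu>) *\<^sub>R ?T \<mu> \<nu>)"
    by (rule ext, rule poisson3_prin_symbol, rule diff)
  then have csub: "csub_symbol E F c x = F c x + cscale (\<i> / 16)
      (\<Sum>\<mu>\<in>UNIV. \<Sum>\<nu>\<in>UNIV. ?g $ \<mu> $ \<nu> *\<^sub>R (?T \<mu> \<nu> + ?T \<nu> \<mu>))"
    by (simp only: csub_symbol_def sub_symbol_def partial_quadratic)
  have "(\<Sum>\<mu>\<in>UNIV. \<Sum>\<nu>\<in>UNIV. ?g $ \<mu> $ \<nu> *\<^sub>R ?T \<nu> \<mu>) = (\<Sum>\<mu>\<in>UNIV. \<Sum>\<nu>\<in>UNIV. ?g $ \<mu> $ \<nu> *\<^sub>R ?T \<mu> \<nu>)"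
    by (subst sum.swap) (simp only: sym)
  then have "(\<Sum>\<mu>\<in>UNIV. \<Sum>\<nu>\<in>UNIV. ?g $ \<mu> $ \<nu> *\<^sub>R (?T \<mu> \<nu> + ?T \<nu> \<mu>)) =
      2 *\<^sub>R (\<Sum>\<mu>\<in>UNIV. \<Sum>\<nu>\<in>UNIV. ?g $ \<mu> $ \<nu> *\<^sub>R ?T \<mu> \<nu>)"
    by (simp only: scaleR_add_right sum.distrib scaleR_2)
  also have "(\<Sum>\<mu>\<in>UNIV. \<Sum>\<nu>\<in>UNIV. ?g $ \<mu> $ \<nu> *\<^sub>R ?T \<mu> \<nu>) =
      (\<Sum>\<mu>\<in>UNIV. \<Sum>\<nu>\<in>UNIV. \<Sum>\<gamma>\<in>UNIV. ?g $ \<mu> $ \<nu> *\<^sub>R bracket_coeff E c x \<gamma> \<mu> \<nu>)"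
    by (simp only: scaleR_sum_right)
  also have "\<dots> = (\<Sum>\<mu>\<in>UNIV. \<Sum>\<gamma>\<in>UNIV. \<Sum>\<nu>\<in>UNIV. ?g $ \<mu> $ \<nu> *\<^sub>R bracket_coeff E c x \<gamma> \<mu> \<nu>)"
    by (rule sum.cong[OF refl], rule sum.swap)
  also have "\<dots> = (\<Sum>\<gamma>\<in>UNIV. contracted_bracket E c x \<gamma>)"
    unfolding contracted_bracket_def by (rule sum.swap)
  finally have "csub_symbol E F c x = F c x +
      cscale (\<i> / 16) (2 *\<^sub>R (\<Sum>\<gamma>\<in>UNIV. contracted_bracket E c x \<gamma>))"
    using csub by (simp only:)
  also have "cscale (\<i> / 16) (2 *\<^sub>R X) = cscale (\<i> / 8) X" for X
    by (simp add: matrix_entries scaleR_conv_of_real[where 'a = complex])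
  finally show ?thesis .
qed

lemma contracted_bracket_eq:
  "contracted_bracket E c x \<gamma> =
     (\<Sum>\<mu>\<in>UNIV. \<Sum>\<nu>\<in>UNIV. (matrix_inv (metric_density E c x) $ \<mu> $ \<nu>) *\<^sub>R
        (pd c \<gamma> (E c \<mu>) x ** adjugate2 (E c \<nu> x))) ** E c \<gamma> x -
     E c \<gamma> x ** (\<Sum>\<mu>\<in>UNIV. \<Sum>\<nu>\<in>UNIV. (matrix_inv (metric_density E c x) $ \<mu> $ \<nu>) *\<^sub>R
        (adjugate2 (E c \<nu> x) ** pd c \<gamma> (E c \<mu>) x))"
  by (simp add: contracted_bracket_def bracket_coeff_def scaleR_diff_right sum_subtractf
      matmul.sum_left matmul.sum_right matmul.scaleR_left matmul.scaleR_right matrix_mul_assoc)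

text \<open>
  The bracket coefficient is a matrix minus its conjugate transpose, hence anti-Hermitian, and the
  factor \<open>\<i>\<close> makes it Hermitian.
\<close>

lemma ctranspose_csub_symbol:
  assumes reg: "hermitian_regular_at E c x" and diff: "\<And>\<beta>. differentiable_in_chart c (E c \<beta>) x"
    and chart: "is_chart c" "x \<in> domc c"
    and herm: "\<And>z \<beta>. z \<in> domc c \<Longrightarrow> ctranspose (E c \<beta> z) = E c \<beta> z"
    and hermF: "ctranspose (F c x) = F c x"
  shows "ctranspose (csub_symbol E F c x) = csub_symbol E F c x"
proof -
  have D: "ctranspose (pd c \<gamma> (E c \<mu>) x) = pd c \<gamma> (E c \<mu>) x" for \<gamma> \<mu>
  proof -
    have "ctranspose (pd c \<gamma> (E c \<mu>) x) = pd c \<gamma> (\<lambda>z. ctranspose (E c \<mu> z)) x"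
      by (rule pd_bounded_linear[OF bounded_linear_ctranspose diff, symmetric])
    also have "\<dots> = pd c \<gamma> (E c \<mu>) x"
      using herm by (intro pd_cong chart differentiable_bounded_linear[OF bounded_linear_ctranspose diff])
    finally show ?thesis .
  qed
  have "ctranspose (bracket_coeff E c x \<gamma> \<mu> \<nu>) = - bracket_coeff E c x \<gamma> \<mu> \<nu>" for \<gamma> \<mu> \<nu>
    by (simp add: bracket_coeff_def ctranspose_linear ctranspose_mult D herm chart
        flip: adjugate2_ctranspose matrix_mul_assoc)
  then have "ctranspose (contracted_bracket E c x \<gamma>) = - contracted_bracket E c x \<gamma>" for \<gamma>
    by (simp add: contracted_bracket_def ctranspose_linear sum_negf)
  then have "ctranspose (\<Sum>\<gamma>\<in>UNIV. contracted_bracket E c x \<gamma>) = - (\<Sum>\<gamma>\<in>UNIV. contracted_bracket E c x \<gamma>)"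
    by (simp add: ctranspose_linear sum_negf)
  then show ?thesis
    by (simp add: csub_symbol_eq[OF reg diff] ctranspose_linear hermF) (simp add: matrix_entries)
qed

text \<open>
  Differentiating \<open>R (adj R) = Id\<close> gives \<open>X + adj X = 0\<close> for \<open>X = R\<^sub>x (adj R)\<close>, and \<open>X + adj X\<close> is
  the trace of \<open>X\<close> times the identity.
\<close>

lemma trace_pd_SL2:
  assumes chart: "is_chart c" "x \<in> domc c"
    and R: "differentiable_in_chart c R x" and det: "\<And>z. z \<in> domc c \<Longrightarrow> det (R z) = 1"
    and inv: "point c (coord c x) = x"
  shows "trace (pd c \<gamma> R x ** adjugate2 (R x)) = 0"
proof -
  let ?X = "pd c \<gamma> R x ** adjugate2 (R x)"
  note adjR = differentiable_bounded_linear[OF bounded_linear_adjugate2 R]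
  have "pd c \<gamma> (\<lambda>z. R z ** adjugate2 (R z)) x = ?X + R x ** adjugate2 (pd c \<gamma> R x)"
    by (simp add: pd_bilinear[OF bounded_bilinear_matmul R adjR inv] pd_bounded_linear[OF bounded_linear_adjugate2 R])
  also have "R x ** adjugate2 (pd c \<gamma> R x) = adjugate2 ?X"
    by (simp add: adjugate2_mult)
  also have "?X + adjugate2 ?X = cscale (trace ?X) (mat 1)"
    by (rule add_adjugate2)
  also have "pd c \<gamma> (\<lambda>z. R z ** adjugate2 (R z)) x = pd c \<gamma> (\<lambda>z. mat 1) x"
    using SL2_inverse[OF det] by (intro pd_cong chart differentiable_bilinear[OF bounded_bilinear_matmul R adjR inv])
  also have "\<dots> = 0"
    by (simp add: pd_def partial_def comp_def frechet_derivative_const)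
  finally show ?thesis by (simp add: matrix_entries)
qed

text \<open>
  Since derivatives of \<open>R\<close> enter, the relation between the principal symbols is assumed on the whole
  chart domain, but the conclusions are drawn at the point \<open>x\<close>.
\<close>

locale SL_gauge_at =
  fixes E E' :: "'m::topological_space vec_coeff" and R :: "'m \<Rightarrow> complex^2^2" and c :: "'m::topological_space chart" and x :: 'm
  assumes chart: "is_chart c" "x \<in> domc c"
    and reg: "hermitian_regular_at E c x"
    and diff_E: "\<And>\<beta>. differentiable_in_chart c (E c \<beta>) x"
    and reg': "hermitian_regular_at E' c x"
    and diff_E': "\<And>\<beta>. differentiable_in_chart c (E' c \<beta>) x"
    and diff_R: "differentiable_in_chart c R x"
    and det_R: "\<And>z. z \<in> domc c \<Longrightarrow> det (R z) = 1"
    and E': "\<And>z \<alpha>. z \<in> domc c \<Longrightarrow> E' c \<alpha> z = ctranspose (R z) ** E c \<alpha> z ** R z"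
    and metric: "metric_density E' c x = metric_density E c x"
begin

lemma point_coord: "point c (coord c x) = x"
  using chart unfolding is_chart_def homeomorphism_def by auto

lemma inverse_R: "R x ** adjugate2 (R x) = mat 1"
    "ctranspose (adjugate2 (R x)) ** ctranspose (R x) = mat 1"
proof -
  show 1: "R x ** adjugate2 (R x) = mat 1" using SL2_inverse det_R chart by blast
  have "ctranspose (R x ** adjugate2 (R x)) = mat 1" by (simp add: 1) (simp add: matrix_entries)
  then show "ctranspose (adjugate2 (R x)) ** ctranspose (R x) = mat 1" by (simp add: ctranspose_mult)
qed

lemma pd_ctranspose_R: "pd c \<gamma> (\<lambda>z. ctranspose (R z)) x = ctranspose (pd c \<gamma> R x)"
  by (rule pd_bounded_linear[OF bounded_linear_ctranspose diff_R])

lemma pd_E':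
  "pd c \<gamma> (E' c \<alpha>) x = ctranspose (pd c \<gamma> R x) ** E c \<alpha> x ** R x +
     ctranspose (R x) ** pd c \<gamma> (E c \<alpha>) x ** R x + ctranspose (R x) ** E c \<alpha> x ** pd c \<gamma> R x"
proof -
  note dR = differentiable_bounded_linear[OF bounded_linear_ctranspose diff_R]
  note d1 = differentiable_bilinear[OF bounded_bilinear_matmul dR diff_E point_coord]
  have "pd c \<gamma> (E' c \<alpha>) x = pd c \<gamma> (\<lambda>z. ctranspose (R z) ** E c \<alpha> z ** R z) x"
    using E' by (intro pd_cong chart diff_E')
  then show ?thesis
    by (simp add: pd_bilinear[OF bounded_bilinear_matmul d1 diff_R point_coord]
        pd_bilinear[OF bounded_bilinear_matmul dR diff_E point_coord] pd_ctranspose_R matmul.add_left)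
qed

lemma adjugate_E': "adjugate2 (E' c \<nu> x) =
    adjugate2 (R x) ** adjugate2 (E c \<nu> x) ** ctranspose (adjugate2 (R x))"
  by (simp add: E' chart adjugate2_mult adjugate2_ctranspose matrix_mul_assoc)

abbreviation "g \<mu> \<nu> \<equiv> matrix_inv (metric_density E c x) $ \<mu> $ \<nu>"

text \<open>
  In the product rule for \<open>R\<^sup>* E\<^sup>\<mu> R\<close> the derivative of the left factor meets \<open>E\<^sup>\<mu> Id (adj E\<^sup>\<nu>)\<close>, and
  the derivative of the right factor meets \<open>E\<^sup>\<mu> X (adj E\<^sup>\<nu>)\<close> with the traceless \<open>X = R\<^sub>x (adj R)\<close>.
\<close>

lemma contraction_left:
  "(\<Sum>\<mu>\<in>UNIV. \<Sum>\<nu>\<in>UNIV. g \<mu> \<nu> *\<^sub>R (pd c \<gamma> (E' c \<mu>) x ** adjugate2 (E' c \<nu> x))) =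
     cscale (- 4) (ctranspose (pd c \<gamma> R x) ** ctranspose (adjugate2 (R x))) +
     ctranspose (R x) ** (\<Sum>\<mu>\<in>UNIV. \<Sum>\<nu>\<in>UNIV. g \<mu> \<nu> *\<^sub>R (pd c \<gamma> (E c \<mu>) x ** adjugate2 (E c \<nu> x)))
       ** ctranspose (adjugate2 (R x))"
proof -
  let ?P = "ctranspose (R x)" and ?P' = "ctranspose (adjugate2 (R x))" and ?Q = "adjugate2 (R x)"
  let ?dR = "pd c \<gamma> R x" and ?a = "\<lambda>\<nu>. adjugate2 (E c \<nu> x)"
  have "pd c \<gamma> (E' c \<mu>) x ** adjugate2 (E' c \<nu> x) =
      ctranspose ?dR ** (E c \<mu> x ** (R x ** ?Q) ** ?a \<nu>) ** ?P' +
      ?P ** (pd c \<gamma> (E c \<mu>) x ** (R x ** ?Q) ** ?a \<nu>) ** ?P' +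
      ?P ** (E c \<mu> x ** (?dR ** ?Q) ** ?a \<nu>) ** ?P'" for \<mu> \<nu>
    by (simp only: pd_E' adjugate_E' matmul.add_left matrix_mul_assoc)
  then have "(\<Sum>\<mu>\<in>UNIV. \<Sum>\<nu>\<in>UNIV. g \<mu> \<nu> *\<^sub>R (pd c \<gamma> (E' c \<mu>) x ** adjugate2 (E' c \<nu> x))) =
      ctranspose ?dR ** (\<Sum>\<mu>\<in>UNIV. \<Sum>\<nu>\<in>UNIV. g \<mu> \<nu> *\<^sub>R (E c \<mu> x ** mat 1 ** ?a \<nu>)) ** ?P' +
      ?P ** (\<Sum>\<mu>\<in>UNIV. \<Sum>\<nu>\<in>UNIV. g \<mu> \<nu> *\<^sub>R (pd c \<gamma> (E c \<mu>) x ** mat 1 ** ?a \<nu>)) ** ?P' +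
      ?P ** (\<Sum>\<mu>\<in>UNIV. \<Sum>\<nu>\<in>UNIV. g \<mu> \<nu> *\<^sub>R (E c \<mu> x ** (?dR ** ?Q) ** ?a \<nu>)) ** ?P'"
    by (simp only: inverse_R scaleR_add_right sum.distrib matmul.sum_left matmul.sum_right
        matmul.scaleR_left matmul.scaleR_right)
  moreover have "trace (?dR ** ?Q) = 0"
    by (rule trace_pd_SL2[OF chart diff_R det_R point_coord])
  moreover have "trace (mat 1 :: complex^2^2) = 2" by (simp add: matrix_entries)
  ultimately show ?thesis
    by (simp add: sandwich_contraction(1)[OF reg] del: matrix_mul_rid) (simp add: matmul.zero_left matmul.zero_right)
qed

text \<open>
  The mirror image of the previous lemma: now the derivative of \<open>R\<^sup>*\<close> produces a traceless matrix and
  the derivative of \<open>R\<close> the factor \<open>-4\<close>.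
\<close>

lemma contraction_right:
  "(\<Sum>\<mu>\<in>UNIV. \<Sum>\<nu>\<in>UNIV. g \<mu> \<nu> *\<^sub>R (adjugate2 (E' c \<nu> x) ** pd c \<gamma> (E' c \<mu>) x)) =
     cscale (- 4) (adjugate2 (R x) ** pd c \<gamma> R x) +
     adjugate2 (R x) ** (\<Sum>\<mu>\<in>UNIV. \<Sum>\<nu>\<in>UNIV. g \<mu> \<nu> *\<^sub>R (adjugate2 (E c \<nu> x) ** pd c \<gamma> (E c \<mu>) x)) ** R x"
proof -
  let ?P = "ctranspose (R x)" and ?P' = "ctranspose (adjugate2 (R x))" and ?Q = "adjugate2 (R x)"
  let ?dR = "pd c \<gamma> R x" and ?a = "\<lambda>\<nu>. adjugate2 (E c \<nu> x)"
  have "adjugate2 (E' c \<nu> x) ** pd c \<gamma> (E' c \<mu>) x =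
      ?Q ** (?a \<nu> ** (?P' ** ctranspose ?dR) ** E c \<mu> x) ** R x +
      ?Q ** (?a \<nu> ** (?P' ** ?P) ** pd c \<gamma> (E c \<mu>) x) ** R x +
      ?Q ** (?a \<nu> ** (?P' ** ?P) ** E c \<mu> x) ** ?dR" for \<mu> \<nu>
    by (simp only: pd_E' adjugate_E' matmul.add_right matrix_mul_assoc)
  then have "(\<Sum>\<mu>\<in>UNIV. \<Sum>\<nu>\<in>UNIV. g \<mu> \<nu> *\<^sub>R (adjugate2 (E' c \<nu> x) ** pd c \<gamma> (E' c \<mu>) x)) =
      ?Q ** (\<Sum>\<mu>\<in>UNIV. \<Sum>\<nu>\<in>UNIV. g \<mu> \<nu> *\<^sub>R (?a \<nu> ** (?P' ** ctranspose ?dR) ** E c \<mu> x)) ** R x +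
      ?Q ** (\<Sum>\<mu>\<in>UNIV. \<Sum>\<nu>\<in>UNIV. g \<mu> \<nu> *\<^sub>R (?a \<nu> ** mat 1 ** pd c \<gamma> (E c \<mu>) x)) ** R x +
      ?Q ** (\<Sum>\<mu>\<in>UNIV. \<Sum>\<nu>\<in>UNIV. g \<mu> \<nu> *\<^sub>R (?a \<nu> ** mat 1 ** E c \<mu> x)) ** ?dR"
    by (simp only: inverse_R scaleR_add_right sum.distrib matmul.sum_left matmul.sum_right
        matmul.scaleR_left matmul.scaleR_right)
  moreover have "trace (?P' ** ctranspose ?dR) = 0"
  proof -
    have "trace (?P' ** ctranspose ?dR) = cnj (trace (?dR ** ?Q))"
      by (simp add: matrix_entries)
    then show ?thesis using trace_pd_SL2[OF chart diff_R det_R point_coord] by simp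
  qed
  moreover have "trace (mat 1 :: complex^2^2) = 2" by (simp add: matrix_entries)
  ultimately show ?thesis
    by (simp add: sandwich_contraction(2)[OF reg] del: matrix_mul_rid) (simp add: matmul.zero_left matmul.zero_right)
qed

lemma contracted_bracket_E':
  "contracted_bracket E' c x \<gamma> = ctranspose (R x) ** contracted_bracket E c x \<gamma> ** R x -
     cscale 4 (ctranspose (pd c \<gamma> R x) ** E c \<gamma> x ** R x - ctranspose (R x) ** E c \<gamma> x ** pd c \<gamma> R x)"
proof -
  let ?P = "ctranspose (R x)" and ?P' = "ctranspose (adjugate2 (R x))" and ?Q = "adjugate2 (R x)"
  let ?dR = "pd c \<gamma> R x"
  let ?L = "\<Sum>\<mu>\<in>UNIV. \<Sum>\<nu>\<in>UNIV. g \<mu> \<nu> *\<^sub>R (pd c \<gamma> (E c \<mu>) x ** adjugate2 (E c \<nu> x))"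
  let ?K = "\<Sum>\<mu>\<in>UNIV. \<Sum>\<nu>\<in>UNIV. g \<mu> \<nu> *\<^sub>R (adjugate2 (E c \<nu> x) ** pd c \<gamma> (E c \<mu>) x)"
  have "contracted_bracket E' c x \<gamma> =
      (cscale (- 4) (ctranspose ?dR ** ?P') + ?P ** ?L ** ?P') ** (?P ** E c \<gamma> x ** R x) -
      (?P ** E c \<gamma> x ** R x) ** (cscale (- 4) (?Q ** ?dR) + ?Q ** ?K ** R x)"
    unfolding contracted_bracket_eq[of E'] metric contraction_left contraction_right
    by (simp only: E'[OF chart(2)])
  also have "\<dots> = cscale (- 4) (ctranspose ?dR ** (?P' ** ?P) ** E c \<gamma> x ** R x) +
      ?P ** ?L ** (?P' ** ?P) ** E c \<gamma> x ** R x -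
      (cscale (- 4) (?P ** E c \<gamma> x ** (R x ** ?Q) ** ?dR) + ?P ** E c \<gamma> x ** (R x ** ?Q) ** ?K ** R x)"
    by (simp only: matmul.add_left matmul.add_right cscale_mult matrix_mul_assoc)
  also have "\<dots> = ?P ** (?L ** E c \<gamma> x - E c \<gamma> x ** ?K) ** R x +
      (cscale (- 4) (ctranspose ?dR ** E c \<gamma> x ** R x) - cscale (- 4) (?P ** E c \<gamma> x ** ?dR))"
    by (simp add: inverse_R matmul.diff_left matmul.diff_right matrix_mul_assoc)
  also have "?L ** E c \<gamma> x - E c \<gamma> x ** ?K = contracted_bracket E c x \<gamma>"
    by (rule contracted_bracket_eq[symmetric])
  also have "cscale (- 4) (ctranspose ?dR ** E c \<gamma> x ** R x) - cscale (- 4) (?P ** E c \<gamma> x ** ?dR) =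
      - cscale 4 (ctranspose ?dR ** E c \<gamma> x ** R x - ?P ** E c \<gamma> x ** ?dR)"
    by (simp add: cscale_linear) (simp add: cscale_def vec_eq_iff)
  finally show ?thesis by simp
qed

abbreviation gauge_term :: "complex^2^2" where
  "gauge_term \<equiv> cscale (\<i> / 2) (\<Sum>\<gamma>\<in>UNIV. ctranspose (pd c \<gamma> R x) ** E c \<gamma> x ** R x -
     ctranspose (R x) ** E c \<gamma> x ** pd c \<gamma> R x)"

text \<open>
  The derivatives of \<open>R\<close> in the correction term have the factor \<open>-4 \<i>/8 = -\<i>/2\<close>, which cancels the
  ones in the transformation rule of the subprincipal symbol.
\<close>

lemma csub_symbol_transform:
  "csub_symbol E' F' c x = ctranspose (R x) ** csub_symbol E F c x ** R x \<longleftrightarrow>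
     F' c x = ctranspose (R x) ** F c x ** R x + gauge_term"
proof -
  have "(\<Sum>\<gamma>\<in>UNIV. contracted_bracket E' c x \<gamma>) =
      ctranspose (R x) ** (\<Sum>\<gamma>\<in>UNIV. contracted_bracket E c x \<gamma>) ** R x -
      cscale 4 (\<Sum>\<gamma>\<in>UNIV. ctranspose (pd c \<gamma> R x) ** E c \<gamma> x ** R x -
        ctranspose (R x) ** E c \<gamma> x ** pd c \<gamma> R x)"
    by (simp add: contracted_bracket_E' sum_subtractf matmul.sum_left matmul.sum_right cscale_linear)
  moreover have "cscale (\<i> / 8) (A - cscale 4 B) = cscale (\<i> / 8) A - cscale (\<i> / 2) B" for A B
    by (simp add: matrix_entries algebra_simps)
  ultimately have "csub_symbol E' F' c x = F' c x + (ctranspose (R x) **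
      cscale (\<i> / 8) (\<Sum>\<gamma>\<in>UNIV. contracted_bracket E c x \<gamma>) ** R x - gauge_term)"
    by (simp add: csub_symbol_eq[OF reg' diff_E'])
  moreover have "ctranspose (R x) ** csub_symbol E F c x ** R x = ctranspose (R x) ** F c x ** R x +
      ctranspose (R x) ** cscale (\<i> / 8) (\<Sum>\<gamma>\<in>UNIV. contracted_bracket E c x \<gamma>) ** R x"
    by (simp only: csub_symbol_eq[OF reg diff_E] matmul.add_left matmul.add_right)
  ultimately show ?thesis by (auto simp: algebra_simps)
qed

end

section \<open>SL-equivalence of symbols\<close>

lemma smooth_SL2_mult:
  assumes "smooth_structure \<A>" and "R \<in> smooth_SL2 \<A>" and "T \<in> smooth_SL2 \<A>"
  shows "(\<lambda>x. R x ** T x) \<in> smooth_SL2 \<A>"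
proof -
  have "smooth_on (coord c ` domc c) ((\<lambda>x. R x ** T x) \<circ> point c)" if "c \<in> \<A>" for c
    using that assms Cn_on_bilinear[OF bounded_bilinear_matmul chart_inverse(5), of c _ "R \<circ> point c" "T \<circ> point c"]
    by (auto simp: smooth_SL2_def smooth_map_def smooth_on_def smooth_structure_def comp_def)
  then show ?thesis using assms by (simp add: smooth_SL2_def smooth_map_def det_mul)
qed

lemma smooth_SL2_inverse:
  assumes "smooth_structure \<A>" and "R \<in> smooth_SL2 \<A>"
  shows "(\<lambda>x. adjugate2 (R x)) \<in> smooth_SL2 \<A>"
proof -
  have "smooth_on (coord c ` domc c) ((\<lambda>x. adjugate2 (R x)) \<circ> point c)" if "c \<in> \<A>" for c
    using that assms Cn_on_bounded_linear[OF bounded_linear_adjugate2 chart_inverse(5), of c _ "R \<circ> point c"]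
    by (auto simp: smooth_SL2_def smooth_map_def smooth_on_def smooth_structure_def comp_def)
  then show ?thesis using assms by (simp add: smooth_SL2_def smooth_map_def det_adjugate2)
qed

lemma smooth_SL2_one: "(\<lambda>x. mat 1) \<in> smooth_SL2 \<A>"
  by (simp add: smooth_SL2_def smooth_map_def smooth_on_def comp_def)

definition prin_related :: "'m chart set \<Rightarrow> ('m \<Rightarrow> complex^2^2) \<Rightarrow> 'm vec_coeff \<Rightarrow> 'm vec_coeff \<Rightarrow> bool" where
  "prin_related \<A> R E E' \<longleftrightarrow> R \<in> smooth_SL2 \<A> \<and>
     (\<forall>c\<in>\<A>. \<forall>x\<in>domc c. \<forall>p. prin_symbol E' c x p = ctranspose (R x) ** prin_symbol E c x p ** R x)"

lemma ctranspose_mat_1 [simp]: "ctranspose (mat 1) = mat 1"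
  by (simp add: matrix_entries)

lemma prin_related_refl: "prin_related \<A> (\<lambda>x. mat 1) E E"
  by (simp add: prin_related_def smooth_SL2_one)

lemma prin_related_trans:
  assumes "smooth_structure \<A>" and "prin_related \<A> R E E'" and "prin_related \<A> T E' E''"
  shows "prin_related \<A> (\<lambda>x. R x ** T x) E E''"
  using assms smooth_SL2_mult[OF assms(1)]
  by (auto simp: prin_related_def ctranspose_mult matrix_mul_assoc)

lemma prin_related_sym:
  assumes "smooth_structure \<A>" and "prin_related \<A> R E E'"
  shows "prin_related \<A> (\<lambda>x. adjugate2 (R x)) E' E"
proof -
  have "ctranspose (adjugate2 (R x)) ** (ctranspose (R x) ** X ** R x) ** adjugate2 (R x) = X" for X x
  proof -
    have inv: "R x ** adjugate2 (R x) = mat 1"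
      using assms(2) by (intro SL2_inverse) (simp add: prin_related_def smooth_SL2_def)
    have "ctranspose (adjugate2 (R x)) ** (ctranspose (R x) ** X ** R x) ** adjugate2 (R x) =
        ctranspose (R x ** adjugate2 (R x)) ** X ** (R x ** adjugate2 (R x))"
      by (simp only: ctranspose_mult matrix_mul_assoc)
    then show ?thesis by (simp add: inv)
  qed
  then show ?thesis
    using assms smooth_SL2_inverse[OF assms(1)] by (simp add: prin_related_def)
qed

lemma spin_structure_eq:
  "spin_structure \<A> \<O> q E = {(E', F').
     smooth_vector_density \<A> E' \<and> smooth_density \<A> F' \<and>
     hermitian_symbol \<A> (full_symbol E' F') \<and> nondegenerate \<A> E' \<and>
     same_field \<A> (encoded_metric E') (encoded_metric E) \<and>
     topological_charge \<O> E' = topological_charge \<O> E \<and>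
     temporal_charge \<A> q E' = temporal_charge \<A> q E \<and> (\<exists>R. prin_related \<A> R E E')}"
  unfolding spin_structure_def prin_related_def Bex_def by blast

text \<open>
  The transformation rule is an identity between affine functions of the momentum; it splits into the
  linear parts and the values at momentum \<open>0\<close>.
\<close>

lemma SL_equivalent_iff:
  "SL_equivalent \<A> (full_symbol E F) (full_symbol E' F') \<longleftrightarrow>
    (\<exists>R. prin_related \<A> R E E' \<and> (\<forall>c\<in>\<A>. \<forall>x\<in>domc c.
       F' c x = ctranspose (R x) ** F c x ** R x + cscale (\<i> / 2) (\<Sum>\<alpha>\<in>UNIV.
         pd c \<alpha> (\<lambda>z. ctranspose (R z)) x ** E c \<alpha> x ** R x -
         ctranspose (R x) ** E c \<alpha> x ** pd c \<alpha> R x)))"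
proof -
  have prin_0: "prin_symbol G c x 0 = 0" for G :: "'a vec_coeff" and c x
    by (simp add: prin_symbol_def)
  have affine: "(\<forall>p. prin_symbol E' c x p + F1 = ctranspose T ** (prin_symbol E c x p + F0) ** T + K) \<longleftrightarrow>
      (\<forall>p. prin_symbol E' c x p = ctranspose T ** prin_symbol E c x p ** T) \<and> F1 = ctranspose T ** F0 ** T + K"
    for c x F0 F1 T K
  proof
    assume *: "\<forall>p. prin_symbol E' c x p + F1 = ctranspose T ** (prin_symbol E c x p + F0) ** T + K"
    from spec[OF this, of 0] have F1: "F1 = ctranspose T ** F0 ** T + K"
      by (simp add: prin_0)
    with * show "(\<forall>p. prin_symbol E' c x p = ctranspose T ** prin_symbol E c x p ** T) \<and> F1 = ctranspose T ** F0 ** T + K"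
      by (simp add: matmul.add_left matmul.add_right)
  qed (simp add: matmul.add_left matmul.add_right)
  show ?thesis
    unfolding SL_equivalent_def prin_related_def partial_full_symbol
    by (auto simp: full_symbol_def sub_symbol_def affine)
qed

text \<open>
  What the non-degenerate Hermitian form contributes: from here on only its coefficients matter.
\<close>

locale hermitian_symbol_on =
  fixes \<A> :: "'m::t2_space chart set" and E :: "'m vec_coeff" and F :: "'m coeff"
  assumes atlas: "smooth_structure \<A>"
    and smooth: "smooth_vector_density \<A> E" "smooth_density \<A> F"
    and hermitian: "\<And>c x \<alpha>. c \<in> \<A> \<Longrightarrow> x \<in> domc c \<Longrightarrow> ctranspose (E c \<alpha> x) = E c \<alpha> x"
      "\<And>c x. c \<in> \<A> \<Longrightarrow> x \<in> domc c \<Longrightarrow> ctranspose (F c x) = F c x"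
    and nondeg: "nondegenerate \<A> E"
begin

lemma is_chart: "c \<in> \<A> \<Longrightarrow> is_chart c"
  using atlas by (simp add: smooth_structure_def)

lemma regular_at: "c \<in> \<A> \<Longrightarrow> x \<in> domc c \<Longrightarrow> hermitian_regular_at E c x"
  using hermitian(1) nondeg by (simp add: hermitian_regular_at_def nondegenerate_def)

lemma differentiable_coeff: "c \<in> \<A> \<Longrightarrow> x \<in> domc c \<Longrightarrow> differentiable_in_chart c (E c \<beta>) x"
  using smooth(1) by (intro smooth_on_imp_differentiable[of "coord c ` domc c"]) (auto simp: smooth_vector_density_def)

lemma hermitian_full_symbol: "hermitian_symbol \<A> (full_symbol E F)"
  by (simp add: hermitian_symbol_def full_symbol_def sub_symbol_def prin_symbol_def ctranspose_linear hermitian)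

lemma em_potential_eqI:
  assumes "c \<in> \<A>" and "x \<in> domc c" and "csub_symbol E F c x = prin_symbol E c x a"
  shows "em_potential E F c x = a"
  unfolding em_potential_def
proof (rule the_equality)
  fix b assume "csub_symbol E F c x = prin_symbol E c x b"
  then have "prin_symbol E c x (b - a) = 0"
    using assms(3) by (simp add: linear_diff[OF bounded_linear.linear[OF bounded_linear_prin_symbol]])
  then have "b - a = 0"
    using regular_at[OF assms(1,2)] unfolding hermitian_regular_at_def by blast
  then show "b = a" by simp
qed (rule assms(3))

text \<open>
  The coefficients of a non-degenerate principal symbol span the four-dimensional space of Hermitian
  matrices, to which the covariant subprincipal symbol belongs.
\<close>

lemma csub_symbol_em_potential:
  assumes c: "c \<in> \<A>" and x: "x \<in> domc c"
  shows "csub_symbol E F c x = prin_symbol E c x (em_potential E F c x)"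
proof -
  note reg = regular_at[OF c x]
  have herm: "ctranspose (csub_symbol E F c x) = csub_symbol E F c x"
    by (rule ctranspose_csub_symbol[OF reg differentiable_coeff[OF c x] is_chart[OF c] x])
      (use hermitian c x in auto)
  obtain N where "coeff_matrix E c x ** N = mat 1"
    using det_coeff_matrix[OF reg] by (metis invertible_det_nz invertible_def)
  then have "coeff_matrix E c x *v (N *v pauli_coord (csub_symbol E F c x)) = pauli_coord (csub_symbol E F c x)"
    by (simp add: matrix_vector_mul_assoc)
  then have "csub_symbol E F c x = prin_symbol E c x (N *v pauli_coord (csub_symbol E F c x))"
    by (simp add: prin_symbol_herm[OF reg] herm_pauli_coord[OF herm])
  with em_potential_eqI[OF c x this] show ?thesis by simp
qed

end

lemma hermitian_symbol_on_form:
  fixes \<A> :: "'m::t2_space chart set"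
  assumes "smooth_structure \<A>" and "canonical_representation \<A> S E F"
    and "hermitian_form \<A> S" and "nondegenerate \<A> E"
  shows "hermitian_symbol_on \<A> E F"
proof
  show "smooth_vector_density \<A> E" "smooth_density \<A> F"
    using assms(2) by (auto simp: canonical_representation_def)
qed (use assms hermitian_coefficients[OF assms(1) _ _ assms(2,3)] in auto)

locale SL_related_symbols =
  S: hermitian_symbol_on \<A> E F + S': hermitian_symbol_on \<A> E' F'
  for \<A> :: "'m::t2_space chart set" and E E' :: "'m vec_coeff" and F F' :: "'m coeff" +
  fixes R :: "'m \<Rightarrow> complex^2^2"
  assumes related: "prin_related \<A> R E E'"
begin

lemma SL_related_at: "c \<in> \<A> \<Longrightarrow> x \<in> domc c \<Longrightarrow> SL_related_at E E' c x (R x)"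
  using related S.regular_at S'.regular_at by unfold_locales (auto simp: prin_related_def smooth_SL2_def)

lemma differentiable_R: "c \<in> \<A> \<Longrightarrow> x \<in> domc c \<Longrightarrow> differentiable_in_chart c R x"
  using related by (intro smooth_on_imp_differentiable[of "coord c ` domc c"])
    (auto simp: prin_related_def smooth_SL2_def smooth_map_def)

lemma SL_gauge_at:
  assumes "c \<in> \<A>" and "x \<in> domc c"
  shows "SL_gauge_at E E' R c x"
proof
  show "det (R z) = 1" for z using related by (simp add: prin_related_def smooth_SL2_def)
  show "E' c \<alpha> z = ctranspose (R z) ** E c \<alpha> z ** R z" if "z \<in> domc c" for z \<alpha>
    using SL_related_at.coeff_eq[OF SL_related_at] assms(1) that by blast
  show "metric_density E' c x = metric_density E c x"
    by (rule SL_related_at.metric_density_eq[OF SL_related_at[OF assms]])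
qed (use assms in \<open>auto simp: S.is_chart S.regular_at S'.regular_at S.differentiable_coeff
    S'.differentiable_coeff differentiable_R\<close>)

lemma sub_symbol_transforms_iff_same_potential:
  assumes c: "c \<in> \<A>" and x: "x \<in> domc c"
  shows "F' c x = ctranspose (R x) ** F c x ** R x + cscale (\<i> / 2) (\<Sum>\<alpha>\<in>UNIV.
         pd c \<alpha> (\<lambda>z. ctranspose (R z)) x ** E c \<alpha> x ** R x -
         ctranspose (R x) ** E c \<alpha> x ** pd c \<alpha> R x) \<longleftrightarrow>
    em_potential E F c x = em_potential E' F' c x" (is "?L \<longleftrightarrow> _")
proof -
  have prin': "prin_symbol E' c x p = ctranspose (R x) ** prin_symbol E c x p ** R x" for p
    using related c x by (simp add: prin_related_def)
  have "?L \<longleftrightarrow> csub_symbol E' F' c x = ctranspose (R x) ** csub_symbol E F c x ** R x"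
    using SL_gauge_at.csub_symbol_transform[OF SL_gauge_at[OF c x]]
      SL_gauge_at.pd_ctranspose_R[OF SL_gauge_at[OF c x]] by simp
  also have "\<dots> \<longleftrightarrow> csub_symbol E' F' c x = prin_symbol E' c x (em_potential E F c x)"
    by (simp add: S.csub_symbol_em_potential[OF c x] prin')
  also have "\<dots> \<longleftrightarrow> em_potential E F c x = em_potential E' F' c x"
    using S'.em_potential_eqI[OF c x] S'.csub_symbol_em_potential[OF c x] by metis
  finally show ?thesis .
qed

lemma same_metric: "same_field \<A> (encoded_metric E) (encoded_metric E')"
  using SL_related_at.encoded_metric_eq[OF SL_related_at] by (simp add: same_field_def)

lemma same_topological_charge:
  assumes "\<O> \<subseteq> \<A>"
  shows "topological_charge \<O> E = topological_charge \<O> E'"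
proof -
  have "sgn (det (frame E' c x)) = sgn (det (frame E c x))" if "c \<in> \<O>" "x \<in> domc c" for c x
    using that assms by (intro SL_related_at.sgn_det_frame_eq[OF SL_related_at]) auto
  then show ?thesis unfolding topological_charge_def by (simp cong: ball_cong)
qed

lemma same_temporal_charge:
  assumes "timelike_covector_field \<A> E q"
  shows "temporal_charge \<A> q E = temporal_charge \<A> q E'"
proof -
  have "sgn (time_vector E' c x \<bullet> q c x) = sgn (time_vector E c x \<bullet> q c x)"
    if "c \<in> \<A>" "x \<in> domc c" for c x
    using that assms by (intro SL_related_at.sgn_time_vector_eq[OF SL_related_at])
      (auto simp: timelike_covector_field_def)
  then show ?thesis unfolding temporal_charge_def by (simp cong: ball_cong)
qed

lemma same_spin_structure:
  assumes "topological_charge \<O> E = topological_charge \<O> E'"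
    and "temporal_charge \<A> q E = temporal_charge \<A> q E'"
  shows "spin_structure \<A> \<O> q E = spin_structure \<A> \<O> q E'"
proof -
  have "(\<exists>T. prin_related \<A> T E E'') \<longleftrightarrow> (\<exists>T. prin_related \<A> T E' E'')" for E''
    using related prin_related_sym[OF S.atlas] prin_related_trans[OF S.atlas] by blast
  moreover have "same_field \<A> (encoded_metric E'') (encoded_metric E) \<longleftrightarrow>
      same_field \<A> (encoded_metric E'') (encoded_metric E')" for E''
    using same_metric by (simp add: same_field_def)
  ultimately show ?thesis unfolding spin_structure_eq assms by simp
qed

end

theorem theorem4p2:
  fixes \<A> \<O> :: "'m::{t2_space,second_countable_topology} chart set"
    and S S' :: "'m sesq_form"
    and E E' :: "'m vec_coeff" and F F' :: "'m coeff"
    and q :: "'m chart \<Rightarrow> 'm \<Rightarrow> real^4"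
  assumes "smooth_structure \<A>" and "connected (UNIV :: 'm set)" and "oriented_atlas \<A> \<O>"
    and "first_order_form \<A> S" and "canonical_representation \<A> S E F"
    and "hermitian_form \<A> S" and "nondegenerate \<A> E"
    and "first_order_form \<A> S'" and "canonical_representation \<A> S' E' F'"
    and "hermitian_form \<A> S'" and "nondegenerate \<A> E'"
    and "timelike_covector_field \<A> E q"
  shows "SL_equivalent \<A> (full_symbol E F) (full_symbol E' F') \<longleftrightarrow>
    same_field \<A> (encoded_metric E) (encoded_metric E') \<and>
    same_field \<A> (em_potential E F) (em_potential E' F') \<and>
    topological_charge \<O> E = topological_charge \<O> E' \<and>
    temporal_charge \<A> q E = temporal_charge \<A> q E' \<and>
    spin_structure \<A> \<O> q E = spin_structure \<A> \<O> q E'"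
proof -
  interpret S: hermitian_symbol_on \<A> E F
    by (rule hermitian_symbol_on_form) fact+
  interpret S': hermitian_symbol_on \<A> E' F'
    by (rule hermitian_symbol_on_form) fact+
  have "\<O> \<subseteq> \<A>" using assms(3) by (simp add: oriented_atlas_def)
  have SL_iff: "SL_equivalent \<A> (full_symbol E F) (full_symbol E' F') \<longleftrightarrow>
      (\<exists>R. prin_related \<A> R E E') \<and> same_field \<A> (em_potential E F) (em_potential E' F')"
  proof -
    have "(\<forall>c\<in>\<A>. \<forall>x\<in>domc c. F' c x = ctranspose (R x) ** F c x ** R x + cscale (\<i> / 2) (\<Sum>\<alpha>\<in>UNIV.
         pd c \<alpha> (\<lambda>z. ctranspose (R z)) x ** E c \<alpha> x ** R x -
         ctranspose (R x) ** E c \<alpha> x ** pd c \<alpha> R x)) \<longleftrightarrow>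
      same_field \<A> (em_potential E F) (em_potential E' F')" if "prin_related \<A> R E E'" for R
    proof -
      interpret SL_related_symbols \<A> E E' F F' R by unfold_locales (rule that)
      show ?thesis
        unfolding same_field_def using sub_symbol_transforms_iff_same_potential by blast
    qed
    then show ?thesis unfolding SL_equivalent_iff by blast
  qed
  show ?thesis
  proof
    assume "SL_equivalent \<A> (full_symbol E F) (full_symbol E' F')"
    then obtain R where R: "prin_related \<A> R E E'"
      and em: "same_field \<A> (em_potential E F) (em_potential E' F')"
      using SL_iff by blast
    interpret SL_related_symbols \<A> E E' F F' R by unfold_locales (rule R)
    show "same_field \<A> (encoded_metric E) (encoded_metric E') \<and>
        same_field \<A> (em_potential E F) (em_potential E' F') \<and>
        topological_charge \<O> E = topological_charge \<O> E' \<and>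
        temporal_charge \<A> q E = temporal_charge \<A> q E' \<and>
        spin_structure \<A> \<O> q E = spin_structure \<A> \<O> q E'"
      using same_metric em same_topological_charge[OF \<open>\<O> \<subseteq> \<A>\<close>] same_temporal_charge[OF assms(12)]
        same_spin_structure by blast
  next
    assume *: "same_field \<A> (encoded_metric E) (encoded_metric E') \<and>
        same_field \<A> (em_potential E F) (em_potential E' F') \<and>
        topological_charge \<O> E = topological_charge \<O> E' \<and>
        temporal_charge \<A> q E = temporal_charge \<A> q E' \<and>
        spin_structure \<A> \<O> q E = spin_structure \<A> \<O> q E'"
    have "(E', F') \<in> spin_structure \<A> \<O> q E'"
      unfolding spin_structure_eq
      using S'.smooth S'.hermitian_full_symbol S'.nondeg prin_related_refl[of \<A> E']
      by (auto simp: same_field_def)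
    then have "(E', F') \<in> spin_structure \<A> \<O> q E" using * by simp
    then show "SL_equivalent \<A> (full_symbol E F) (full_symbol E' F')"
      using * SL_iff unfolding spin_structure_eq by blast
  qed
qed

end
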